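(* Let $\kappa$ be a regular cardinal and let $\lambda$ be a cardinal. Then the cofibrantly replaced left derived functor of $\mathrm{card}:\mathrm{QtNaamen}^+_\kappa\to On^\top$ is Shelah's revised power function, that is, $$\mathbb{L}_c\mathrm{card}(\{\lambda\})=\lambda^{[\kappa]}:=\mathrm{cov}(\lambda,\kappa^+,\kappa^+,\kappa).$$
   Context: Work in ZFC with classes (for example, fix a transitive set model $V$ of ZFC and read "class" as "definable subset of $V$"). For classes of sets $X,Y$ write $X\to Y$ iff for every $x\in X$ there is $y\in Y$ with $x\subseteq y$. For a class $X$ of sets put $\bigcup_{<\kappa}X=\{\bigcup S: S\subseteq X,\ \mathrm{card}\,S<\kappa\}$. **The labelled category $\mathrm{StNaamen}_\kappa$.** Objects are the $\kappa$-directed classes of sets, i.e. those $X$ with $\bigcup_{<\kappa}X\to X$; there is at most one arrow between objects, given by $X\to Y$. An arrow $X\to Y$ is labelled - (wc) iff $\forall y\in Y\ \exists x\in X\ (\mathrm{card}(y\setminus x)<\kappa)$; - (c) iff $\forall y\in Y\ \exists x\in X\ (\mathrm{card}\,y\le\mathrm{card}\,x+\kappa)$; - (wf) iff $\forall x\in X\ \forall y\in Y\ \forall y'\subseteq y\ \exists x'\in X\ (\mathrm{card}\,y'\le\mathrm{card}\,x+\kappa\Rightarrow y'\subseteq x')$; - (w) iff there is $Z$ in $\mathrm{StNaamen}_\kappa$ with $X\xrightarrow{(wc)}Z\xrightarrow{(wf)}Y$. An object $X$ of $\mathrm{StNaamen}_\kappa$ is *cute* if: whenever $A\subseteq B$ are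 sets with $\{A\}\xrightarrow{(c)}\{B\}$, $W$ is an object with $W\xrightarrow{(wf)}\{B\}$, $W\to X$ and $\{A\}\to X$, then $\{B\}\to X$. **The labelled category $\mathrm{QtNaamen}^+_\kappa$.** Objects are all classes $X$ of sets such that $\bigcup_{<\kappa}X$ is cute in $\mathrm{StNaamen}_\kappa$. There is a (unique) arrow from $X$ to $Y$ iff $\bigcup_{<\kappa}X\to\bigcup_{<\kappa}Y$, and this arrow carries exactly the labels of $\bigcup_{<\kappa}X\to\bigcup_{<\kappa}Y$ in $\mathrm{StNaamen}_\kappa$. The initial object $\perp$ is the empty class (isomorphic to $\{\emptyset\}$). **Derived functor.** $On^\top$ is the ordered class of ordinals with an added top element $\top$; $\mathrm{card}(X)$ is the cardinality of $X$ if $X$ is a set, and $\top$ otherwise. For objects of $\mathrm{QtNaamen}^+_\kappa$ write $X\to_h Y$ if for some $n$ there is a finite zigzag $X\to X_1\xleftarrow{(w)}X_2\to X_3\xleftarrow{(w)}\cdots\to X_n\to Y$ of arrows of $\mathrm{QtNaamen}^+_\kappa$. Then $$\mathbb{L}_c\mathrm{card}(X)=\min\{\mathrm{card}(Y): X\to_h Y,\ \perp\xrightarrow{(c)}Y\},$$ with $Y$ ranging over objects of $\mathrm{QtNaamen}^+_\kappa$. **Covering numbers.** $\mathrm{cov}(\lambda,\Delta,\theta,\sigma)$ is the least size of a family $X\subseteq[\lambda]^{<\Delta}$ such that every subset of $\lambda$ of cardinality less than $\theta$ is contained in a union of fewer than $\sigma$ members of $X$.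
   Formalization: The formal theorem assumes λ = 0 or λ ≥ κ; for 0 < λ < κ the printed equation fails, since ⊥ has a (w)-arrow to {λ}, so L_c card({λ}) = 0 while cov(λ,κ⁺,κ⁺,κ) = 1. *)

theory Defs
  imports Main
begin

section \<open>First-order set theory\<close>

text \<open>
  ZFC has infinitely many axioms, and a class is a subset of the model that is definable with
  parameters; both need the formulas of the language of set theory. Variables are numbered.
\<close>

datatype fm = Mem nat nat | Equal nat nat | Neg fm | Conj fm fm | Ex nat fm

locale membership =
  fixes mem :: "'v \<Rightarrow> 'v \<Rightarrow> bool" (infix "\<in>\<^sub>V" 50)
begin

primrec sat :: "(nat \<Rightarrow> 'v) \<Rightarrow> fm \<Rightarrow> bool" where
  "sat e (Mem i j) \<longleftrightarrow> e i \<in>\<^sub>V e j"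
| "sat e (Equal i j) \<longleftrightarrow> e i = e j"
| "sat e (Neg p) \<longleftrightarrow> \<not> sat e p"
| "sat e (Conj p q) \<longleftrightarrow> sat e p \<and> sat e q"
| "sat e (Ex i p) \<longleftrightarrow> (\<exists>x. sat (e(i := x)) p)"

definition is_class :: "'v set \<Rightarrow> bool" where
  "is_class X \<longleftrightarrow> (\<exists>p e. X = {x. sat (e(0 := x)) p})"

definition elts :: "'v \<Rightarrow> 'v set" where
  "elts x = {y. y \<in>\<^sub>V x}"

definition is_set :: "'v set \<Rightarrow> bool" where
  "is_set X \<longleftrightarrow> (\<exists>x. elts x = X)"

definition set_of :: "'v set \<Rightarrow> 'v" where
  "set_of X = (THE x. elts x = X)"

end

locale zfc = membership mem for mem :: "'v \<Rightarrow> 'v \<Rightarrow> bool" (infix "\<in>\<^sub>V" 50) +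
  assumes extensionality: "elts x = elts y \<Longrightarrow> x = y"
    and foundation: "elts x \<noteq> {} \<Longrightarrow> \<exists>y\<in>elts x. elts y \<inter> elts x = {}"
    and pairing: "is_set {x, y}"
    and union: "is_set (\<Union>y\<in>elts x. elts y)"
    and powerset: "is_set {y. elts y \<subseteq> elts x}"
    and infinity: "\<exists>w. (\<exists>z\<in>elts w. elts z = {}) \<and>
                       (\<forall>x\<in>elts w. \<exists>s\<in>elts w. elts s = insert x (elts x))"
    and separation: "is_set {y \<in> elts x. sat (e(0 := y)) p}"
    and replacement: "(\<And>u. u \<in> elts x \<Longrightarrow> \<exists>!v. sat (e(0 := u, 1 := v)) p) \<Longrightarrow>
                      is_set {v. \<exists>u\<in>elts x. sat (e(0 := u, 1 := v)) p}"
    and choice: "\<lbrakk>\<And>y. y \<in> elts x \<Longrightarrow> elts y \<noteq> {};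
                  \<And>y z. \<lbrakk>y \<in> elts x; z \<in> elts x; y \<noteq> z\<rbrakk> \<Longrightarrow> elts y \<inter> elts z = {}\<rbrakk> \<Longrightarrow>
                 \<exists>c. \<forall>y\<in>elts x. \<exists>!z. z \<in> elts c \<inter> elts y"

text \<open>
  By Mostowski's collapsing theorem, the well-founded models are, up to isomorphism, the
  transitive ones.
\<close>

locale transitive_zfc_model = zfc mem for mem :: "'v \<Rightarrow> 'v \<Rightarrow> bool" (infix "\<in>\<^sub>V" 50) +
  assumes wellfounded: "wfp (\<in>\<^sub>V)"

context membership
begin

section \<open>Cardinals, computed inside the model\<close>

definition opair :: "'v \<Rightarrow> 'v \<Rightarrow> 'v" where
  "opair a b = set_of {set_of {a}, set_of {a, b}}"

text \<open>The bijection has to belong to the model: its graph is a set.\<close>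

definition equinumerous :: "'v \<Rightarrow> 'v \<Rightarrow> bool" (infix "\<approx>\<^sub>V" 50) where
  "x \<approx>\<^sub>V y \<longleftrightarrow> (\<exists>f. bij_betw f (elts x) (elts y) \<and> is_set ((\<lambda>a. opair a (f a)) ` elts x))"

text \<open>This characterizes ordinals because of foundation.\<close>

definition ordinal :: "'v \<Rightarrow> bool" where
  "ordinal a \<longleftrightarrow> (\<forall>b\<in>elts a. elts b \<subseteq> elts a) \<and> (\<forall>b\<in>elts a. \<forall>c\<in>elts b. elts c \<subseteq> elts b)"

definition ord_le :: "'v \<Rightarrow> 'v \<Rightarrow> bool" (infix "\<le>\<^sub>V" 50) where
  "a \<le>\<^sub>V b \<longleftrightarrow> a \<in>\<^sub>V b \<or> a = b"

definition cardinal :: "'v \<Rightarrow> bool" where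
  "cardinal k \<longleftrightarrow> ordinal k \<and> (\<forall>b\<in>elts k. \<not> b \<approx>\<^sub>V k)"

definition vcard :: "'v \<Rightarrow> 'v" where
  "vcard x = (THE k. cardinal k \<and> k \<approx>\<^sub>V x)"

definition cadd :: "'v \<Rightarrow> 'v \<Rightarrow> 'v" where
  "cadd a b = (THE c. cardinal c \<and>
     (\<exists>u v. elts u \<inter> elts v = {} \<and> elts u \<union> elts v = elts c \<and> u \<approx>\<^sub>V a \<and> v \<approx>\<^sub>V b))"

definition csucc :: "'v \<Rightarrow> 'v" where
  "csucc k = (THE c. cardinal c \<and> k \<in>\<^sub>V c \<and> (\<forall>d. cardinal d \<and> k \<in>\<^sub>V d \<longrightarrow> c \<le>\<^sub>V d))"

text \<open>Regular cardinals are infinite; a cardinal is infinite iff it is a nonzero limit ordinal.\<close>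

definition infinite_cardinal :: "'v \<Rightarrow> bool" where
  "infinite_cardinal k \<longleftrightarrow> cardinal k \<and> elts k \<noteq> {} \<and> (\<forall>a\<in>elts k. \<exists>b\<in>elts k. a \<in>\<^sub>V b)"

definition regular :: "'v \<Rightarrow> bool" where
  "regular k \<longleftrightarrow> infinite_cardinal k \<and>
     (\<forall>x. elts x \<subseteq> elts k \<and> vcard x \<in>\<^sub>V k \<longrightarrow> (\<exists>b\<in>elts k. \<forall>a\<in>elts x. a \<in>\<^sub>V b))"

section \<open>Covering numbers\<close>

definition covering_family :: "'v \<Rightarrow> 'v \<Rightarrow> 'v \<Rightarrow> 'v \<Rightarrow> 'v \<Rightarrow> bool" where
  "covering_family l D t s X \<longleftrightarrow>
     (\<forall>x\<in>elts X. elts x \<subseteq> elts l \<and> vcard x \<in>\<^sub>V D) \<and>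
     (\<forall>y. elts y \<subseteq> elts l \<and> vcard y \<in>\<^sub>V t \<longrightarrow>
        (\<exists>S. elts S \<subseteq> elts X \<and> vcard S \<in>\<^sub>V s \<and> elts y \<subseteq> (\<Union>x\<in>elts S. elts x)))"

definition cov :: "'v \<Rightarrow> 'v \<Rightarrow> 'v \<Rightarrow> 'v \<Rightarrow> 'v" where
  "cov l D t s = (THE c. (\<exists>X. covering_family l D t s X \<and> c = vcard X) \<and>
                         (\<forall>X. covering_family l D t s X \<longrightarrow> c \<le>\<^sub>V vcard X))"

text \<open>
  For \<open>0 < l < k\<close> this is 1, whereas \<open>Lc_card k {l}\<close> below is 0, because the empty class has an arrow
  labelled (w) to \<open>{l}\<close>; the two agree for \<open>l = 0\<close> and for \<open>k \<le> l\<close>.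
\<close>

definition revised_power :: "'v \<Rightarrow> 'v \<Rightarrow> 'v" where
  "revised_power l k = cov l (csucc k) (csucc k) k"

section \<open>The labelled category StNaamen\<close>

definition below :: "'v set \<Rightarrow> 'v set \<Rightarrow> bool" where
  "below X Y \<longleftrightarrow> (\<forall>x\<in>X. \<exists>y\<in>Y. elts x \<subseteq> elts y)"

definition Union_lt :: "'v \<Rightarrow> 'v set \<Rightarrow> 'v set" where
  "Union_lt k X =
     {u. \<exists>S. elts S \<subseteq> X \<and> vcard S \<in>\<^sub>V k \<and> elts u = (\<Union>x\<in>elts S. elts x)}"

definition St_obj :: "'v \<Rightarrow> 'v set \<Rightarrow> bool" where
  "St_obj k X \<longleftrightarrow> is_class X \<and> below (Union_lt k X) X"

definition St_arr :: "'v \<Rightarrow> 'v set \<Rightarrow> 'v set \<Rightarrow> bool" where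
  "St_arr k X Y \<longleftrightarrow> St_obj k X \<and> St_obj k Y \<and> below X Y"

definition St_wc :: "'v \<Rightarrow> 'v set \<Rightarrow> 'v set \<Rightarrow> bool" where
  "St_wc k X Y \<longleftrightarrow> St_arr k X Y \<and>
     (\<forall>y\<in>Y. \<exists>x\<in>X. vcard (set_of (elts y - elts x)) \<in>\<^sub>V k)"

definition St_c :: "'v \<Rightarrow> 'v set \<Rightarrow> 'v set \<Rightarrow> bool" where
  "St_c k X Y \<longleftrightarrow> St_arr k X Y \<and>
     (\<forall>y\<in>Y. \<exists>x\<in>X. vcard y \<le>\<^sub>V cadd (vcard x) k)"

definition St_wf :: "'v \<Rightarrow> 'v set \<Rightarrow> 'v set \<Rightarrow> bool" where
  "St_wf k X Y \<longleftrightarrow> St_arr k X Y \<and>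
     (\<forall>x\<in>X. \<forall>y\<in>Y. \<forall>y'. elts y' \<subseteq> elts y \<longrightarrow>
        (\<exists>x'\<in>X. vcard y' \<le>\<^sub>V cadd (vcard x) k \<longrightarrow> elts y' \<subseteq> elts x'))"

definition St_w :: "'v \<Rightarrow> 'v set \<Rightarrow> 'v set \<Rightarrow> bool" where
  "St_w k X Y \<longleftrightarrow> St_arr k X Y \<and> (\<exists>Z. St_wc k X Z \<and> St_wf k Z Y)"

definition cute :: "'v \<Rightarrow> 'v set \<Rightarrow> bool" where
  "cute k X \<longleftrightarrow> St_obj k X \<and>
     (\<forall>A B W. elts A \<subseteq> elts B \<and> St_c k {A} {B} \<and> St_obj k W \<and> St_wf k W {B} \<and>
        St_arr k W X \<and> St_arr k {A} X \<longrightarrow> St_arr k {B} X)"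

section \<open>The labelled category QtNaamen\<close>

definition Qt_obj :: "'v \<Rightarrow> 'v set \<Rightarrow> bool" where
  "Qt_obj k X \<longleftrightarrow> is_class X \<and> cute k (Union_lt k X)"

definition Qt_arr :: "'v \<Rightarrow> 'v set \<Rightarrow> 'v set \<Rightarrow> bool" where
  "Qt_arr k X Y \<longleftrightarrow> Qt_obj k X \<and> Qt_obj k Y \<and> St_arr k (Union_lt k X) (Union_lt k Y)"

definition Qt_c :: "'v \<Rightarrow> 'v set \<Rightarrow> 'v set \<Rightarrow> bool" where
  "Qt_c k X Y \<longleftrightarrow> Qt_arr k X Y \<and> St_c k (Union_lt k X) (Union_lt k Y)"

definition Qt_w :: "'v \<Rightarrow> 'v set \<Rightarrow> 'v set \<Rightarrow> bool" where
  "Qt_w k X Y \<longleftrightarrow> Qt_arr k X Y \<and> St_w k (Union_lt k X) (Union_lt k Y)"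

text \<open>
  The zigzag \<open>X = F 0 \<rightarrow> F 1 \<leftarrow> F 2 \<rightarrow> F 3 \<leftarrow> \<dots> \<rightarrow> F n \<rightarrow> Y\<close>, whose leftward arrows are labelled (w).
\<close>

definition Qt_h :: "'v \<Rightarrow> 'v set \<Rightarrow> 'v set \<Rightarrow> bool" where
  "Qt_h k X Y \<longleftrightarrow> (\<exists>n F. odd n \<and> F 0 = X \<and>
     (\<forall>i<n. if even i then Qt_arr k (F i) (F (Suc i)) else Qt_w k (F (Suc i)) (F i)) \<and>
     Qt_arr k (F n) Y)"

end

section \<open>The derived functor of cardinality\<close>

datatype 'v on_top = Ord 'v | Top

context membership
begin

fun top_le :: "'v on_top \<Rightarrow> 'v on_top \<Rightarrow> bool" where
  "top_le _ Top \<longleftrightarrow> True"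
| "top_le Top (Ord b) \<longleftrightarrow> False"
| "top_le (Ord a) (Ord b) \<longleftrightarrow> a \<le>\<^sub>V b"

definition class_card :: "'v set \<Rightarrow> 'v on_top" where
  "class_card X = (if is_set X then Ord (vcard (set_of X)) else Top)"

definition Lc_card :: "'v \<Rightarrow> 'v set \<Rightarrow> 'v on_top" where
  "Lc_card k X = (THE m. (\<exists>Y. Qt_h k X Y \<and> Qt_c k {} Y \<and> m = class_card Y) \<and>
                         (\<forall>Y. Qt_h k X Y \<and> Qt_c k {} Y \<longrightarrow> top_le m (class_card Y)))"

end

end

theory Submission
  imports Defs
begin

text \<open>
  An object \<open>Y\<close> receiving an arrow (c) from the initial object consists of sets of size at most \<open>\<kappa>\<close>.
  Upper bound: a covering family \<open>C\<close> of least size is an object, its unions of fewer than \<open>\<kappa>\<close> members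
  contain every subset of \<open>\<mu>\<close> of size at most \<open>\<kappa>\<close>, hence \<open>C\<close> has an arrow (w) to \<open>{\<mu>}\<close>, and
  \<open>{\<mu>} = {\<mu>} \<leftarrow> C = C\<close> is a zigzag.
  Lower bound: say that \<open>X\<close> almost covers \<open>\<mu>\<close> if every subset of \<open>\<mu>\<close> of size at most \<open>\<kappa>\<close> is contained
  in an element of \<open>X\<close> up to fewer than \<open>\<kappa>\<close> points. This passes forward along all arrows and backward
  along arrows (w), so it reaches \<open>Y\<close>. Then the part of \<open>\<mu>\<close> outside \<open>\<Union>Y\<close> has size less than \<open>\<kappa>\<close>, and
  adding it to every member of \<open>Y\<close> gives a covering family.

  All cardinalities are computed inside the model. A bijection in the model is the same as the
  restriction to a set of a function definable with parameters, so it suffices to see that each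
  function and each set used is definable.
\<close>

section \<open>Definability with parameters\<close>

context membership
begin

text \<open>Covering up to fewer than \<kappa> points, rather than exactly, is the right invariant
  because an arrow (wc) may lose that many points of a set, and every arrow (w) walked backward
  contains such a step. The loss costs nothing in the end: a lost point of \<Union>Y lies in some
  member of Y, and one member for each lost point still leaves a union of fewer than \<kappa>
  members. Enlarging the members by the points outside \<Union>Y presupposes that there is a member.
  This is where the assumption on \<mu> enters: if Y is empty, then \<mu> has size below \<kappa>
  and must itself be empty.

  The technical obstacle is that HOL sees the model from outside. Its bijections, choice functions
  and recursive functions need not belong to the model, so Schroeder-Bernstein, enumeration by
  ordinals and the existence of cardinals are established for definable functions. Minimal elements,
  in contrast, may be taken for arbitrary predicates. The central fact of cardinal arithmetic is
  that fewer than \<kappa> sets of size at most \<kappa> have a union of size at most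
  \<kappa>.\<close>

primrec rename :: "(nat \<Rightarrow> nat) \<Rightarrow> fm \<Rightarrow> fm" where
  "rename f (Mem i j) = Mem (f i) (f j)"
| "rename f (Equal i j) = Equal (f i) (f j)"
| "rename f (Neg p) = Neg (rename f p)"
| "rename f (Conj p q) = Conj (rename f p) (rename f q)"
| "rename f (Ex i p) = Ex (f i) (rename f p)"

text \<open>Bound variables are renamed too; injectivity keeps the quantified variable apart from
  all others, so nothing is captured.\<close>

lemma sat_rename: "inj f \<Longrightarrow> sat e (rename f p) \<longleftrightarrow> sat (e \<circ> f) p"
proof (induction p arbitrary: e)
  case (Ex i p)
  have "(e(f i := x)) \<circ> f = (e \<circ> f)(i := x)" for x
    using Ex.prems by (auto simp: fun_eq_iff inj_eq)
  then show ?case unfolding sat.simps rename.simps Ex.IH[OF Ex.prems] by simp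
qed auto

text \<open>Even variables hold the arguments of a predicate, odd variables its parameters.\<close>

definition mix :: "(nat \<Rightarrow> 'v) \<Rightarrow> (nat \<Rightarrow> 'v) \<Rightarrow> nat \<Rightarrow> 'v" where
  "mix e s n = (if even n then e (n div 2) else s (n div 2))"

definition def_pred :: "((nat \<Rightarrow> 'v) \<Rightarrow> bool) \<Rightarrow> bool" where
  "def_pred P \<longleftrightarrow> (\<exists>p s. \<forall>e. P e \<longleftrightarrow> sat (mix e s) p)"

text \<open>Arguments are numbered as de Bruijn indices: \<open>\<lambda>i. e (Suc i)\<close> is \<open>e\<close> without its first entry.\<close>

definition def_term :: "((nat \<Rightarrow> 'v) \<Rightarrow> 'v) \<Rightarrow> bool" where
  "def_term t \<longleftrightarrow> def_pred (\<lambda>e. e 0 = t (\<lambda>i. e (Suc i)))"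

definition class_fun :: "('v \<Rightarrow> 'v) \<Rightarrow> bool" where
  "class_fun f \<longleftrightarrow> def_term (\<lambda>e. f (e 0))"

definition def_class :: "'v set \<Rightarrow> bool" where
  "def_class X \<longleftrightarrow> def_pred (\<lambda>e. e 0 \<in> X)"

lemma def_pred_via_rename:
  assumes "inj f" "\<And>e. Q e \<longleftrightarrow> sat (mix e s \<circ> f) p"
  shows "def_pred Q"
  unfolding def_pred_def using assms sat_rename by metis

lemma def_pred_reindex:
  assumes "def_pred P" "inj f"
  shows "def_pred (\<lambda>e. P (\<lambda>i. e (f i)))"
proof -
  obtain p s where p: "\<And>e. P e \<longleftrightarrow> sat (mix e s) p" using assms(1) unfolding def_pred_def by auto
  \<comment> \<open>Arguments sit at even positions, so \<open>f\<close> acts there, and the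
    parameters stay where they are.\<close>
  let ?g = "\<lambda>n. if even n then 2 * f (n div 2) else n"
  have "inj ?g"
  proof (rule injI)
    fix m n assume *: "?g m = ?g n"
    show "m = n"
    proof (cases "even m = even n")
      case True
      then show ?thesis using * assms(2)
        by (auto simp: inj_eq split: if_splits elim!: evenE)
    next
      case False
      then show ?thesis using * by (metis dvd_triv_left)
    qed
  qed
  moreover have "mix (\<lambda>i. e (f i)) s = mix e s \<circ> ?g" for e
    by (auto simp: fun_eq_iff mix_def)
  ultimately show ?thesis by (intro def_pred_via_rename[of ?g _ s p]) (simp_all add: p)
qed

section \<open>Closure of definability under logical operations and substitution\<close>

lemma def_pred_not: "def_pred P \<Longrightarrow> def_pred (\<lambda>e. \<not> P e)"
  unfolding def_pred_def by (metis sat.simps(3))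

lemma def_pred_conj:
  assumes "def_pred P" "def_pred Q"
  shows "def_pred (\<lambda>e. P e \<and> Q e)"
proof -
  obtain p s where p: "\<And>e. P e \<longleftrightarrow> sat (mix e s) p" using assms(1) unfolding def_pred_def by auto
  obtain q r where q: "\<And>e. Q e \<longleftrightarrow> sat (mix e r) q" using assms(2) unfolding def_pred_def by auto
  \<comment> \<open>The two parameter lists are interleaved into \<open>mix s r\<close>;
    \<open>?f\<close> and \<open>?g\<close> send the odd variables of each formula to its own
    half.\<close>
  let ?f = "\<lambda>n::nat. if even n then n else 2 * (2 * (n div 2)) + 1"
  let ?g = "\<lambda>n::nat. if even n then n else 2 * (2 * (n div 2) + 1) + 1"
  have inj: "inj ?f" "inj ?g" by (auto intro!: injI elim!: oddE split: if_splits)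
  have "mix e (mix s r) \<circ> ?f = mix e s" "mix e (mix s r) \<circ> ?g = mix e r" for e
    by (auto simp: fun_eq_iff mix_def elim!: oddE)
  then have "P e \<and> Q e \<longleftrightarrow> sat (mix e (mix s r)) (Conj (rename ?f p) (rename ?g q))" for e
    by (simp add: sat_rename[OF inj(1)] sat_rename[OF inj(2)] p q)
  then show ?thesis unfolding def_pred_def by blast
qed

lemma def_pred_ex:
  assumes "def_pred (\<lambda>e. P (e 0) (\<lambda>i. e (Suc i)))"
  shows "def_pred (\<lambda>e. \<exists>x. P x e)"
proof -
  obtain p s where p: "\<forall>e. P (e 0) (\<lambda>i. e (Suc i)) \<longleftrightarrow> sat (mix e s) p"
    using assms unfolding def_pred_def by (elim exE)
  \<comment> \<open>Argument 0 becomes the bound variable 1, the other arguments move down one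
    place, and the parameters move up one place to make room for it. The entry of \<open>?s\<close>
    at the freed place is a dummy.\<close>
  let ?f = "\<lambda>n::nat. if n = 0 then 1 else if even n then n - 2 else n + 2"
  let ?s = "\<lambda>n. s (n - 1)"
  have split: thesis if "n = 0 \<Longrightarrow> thesis" "\<And>k. n = 2 * Suc k \<Longrightarrow> thesis" "\<And>k. n = 2 * k + 1 \<Longrightarrow> thesis"
    for n :: nat and thesis
  proof (cases "even n")
    case True
    then obtain k where "n = 2 * k" by (elim evenE)
    then show ?thesis using that(1,2) by (cases k) auto
  next
    case False
    then show ?thesis using that(3) by (elim oddE)
  qed
  have "inj ?f"
  proof (rule inj_on_inverseI[where g = "\<lambda>n. if n = 1 then 0 else if odd n then n - 2 else n + 2"])
    fix n :: nat
    show "(if ?f n = 1 then 0 else if odd (?f n) then ?f n - 2 else ?f n + 2) = n"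
      by (rule split[of n]) simp_all
  qed
  moreover have "mix (case_nat x e) s = (mix e ?s)(1 := x) \<circ> ?f" for e x
  proof
    fix n
    show "mix (case_nat x e) s n = ((mix e ?s)(1 := x) \<circ> ?f) n"
      by (rule split[of n]) (simp_all add: mix_def)
  qed
  ultimately have "sat (mix (case_nat x e) s) p \<longleftrightarrow> sat ((mix e ?s)(1 := x)) (rename ?f p)" for e x
    by (simp only: sat_rename)
  moreover have "P x e \<longleftrightarrow> sat (mix (case_nat x e) s) p" for x e
    using spec[OF p, of "case_nat x e"] by simp
  ultimately have "(\<exists>x. P x e) \<longleftrightarrow> sat (mix e ?s) (Ex 1 (rename ?f p))" for e
    by simp
  then show ?thesis unfolding def_pred_def by blast
qed

lemma def_pred_mem_var: "def_pred (\<lambda>e. e i \<in>\<^sub>V e j)"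
  unfolding def_pred_def by (rule exI[of _ "Mem (2*i) (2*j)"]) (simp add: mix_def)

lemma def_pred_eq_var: "def_pred (\<lambda>e. e i = e j)"
  unfolding def_pred_def by (rule exI[of _ "Equal (2*i) (2*j)"]) (simp add: mix_def)

lemma def_pred_const: "def_pred (\<lambda>e. b)"
proof (cases b)
  case True
  then show ?thesis using def_pred_eq_var[of 0 0] by simp
next
  case False
  then show ?thesis using def_pred_not[OF def_pred_eq_var[of 0 0]] by simp
qed

lemma def_term_var: "def_term (\<lambda>e. e n)"
  unfolding def_term_def by (rule def_pred_eq_var)

lemma def_term_const: "def_term (\<lambda>e. c)"
  unfolding def_term_def def_pred_def
  by (rule exI[of _ "Equal 0 1"], rule exI[of _ "\<lambda>_. c"]) (simp add: mix_def)

lemma def_term_shift: "def_term t \<Longrightarrow> def_term (\<lambda>e. t (\<lambda>i. e (Suc i)))"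
  unfolding def_term_def
  using def_pred_reindex[of "\<lambda>e. e 0 = t (\<lambda>i. e (Suc i))" "\<lambda>i. if i = 0 then 0 else Suc i"]
  by (simp add: inj_def)

text \<open>The language has no function symbols, so a term is substituted by quantifying over its
  value.\<close>

lemma def_pred_subst1:
  assumes "def_pred (\<lambda>e. Q (e 0))" "def_term t"
  shows "def_pred (\<lambda>e. Q (t e))"
proof -
  have "def_pred (\<lambda>e. \<exists>x. x = t e \<and> Q x)"
    using assms unfolding def_term_def by (intro def_pred_ex def_pred_conj)
  then show ?thesis by simp
qed

lemma def_pred_subst2:
  assumes "def_pred (\<lambda>e. Q (e 0) (e (Suc 0)))" "def_term t" "def_term s"
  shows "def_pred (\<lambda>e. Q (t e) (s e))"
proof -
  \<comment> \<open>Under two quantifiers the outer variable \<open>x\<close> has index 1 and the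
    inner variable \<open>y\<close> has index 0, hence the swap.\<close>
  have "def_pred (\<lambda>e. Q (e (Suc 0)) (e 0))"
    using def_pred_reindex[OF assms(1), of "\<lambda>i. if i = 0 then 1 else if i = 1 then 0 else i"]
    by (simp add: inj_def)
  moreover have "def_pred (\<lambda>e. e 0 = s (\<lambda>i. e (Suc (Suc i))))"
    using def_term_shift[OF assms(3)] unfolding def_term_def .
  ultimately have "def_pred (\<lambda>e. \<exists>x. x = t e \<and> (\<exists>y. y = s e \<and> Q x y))"
    using assms(2) unfolding def_term_def by (intro def_pred_ex def_pred_conj)
  then show ?thesis by simp
qed

lemma def_pred_subst3:
  assumes "def_pred (\<lambda>e. Q (e 0) (e (Suc 0)) (e (Suc (Suc 0))))" "def_term t" "def_term s" "def_term r"
  shows "def_pred (\<lambda>e. Q (t e) (s e) (r e))"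
proof -
  have "def_pred (\<lambda>e. Q (e (Suc (Suc 0))) (e (Suc 0)) (e 0))"
    using def_pred_reindex[OF assms(1), of "\<lambda>i. if i = 0 then 2 else if i = 2 then 0 else i"]
    by (simp add: inj_def numeral_2_eq_2)
  moreover have "def_pred (\<lambda>e. e 0 = s (\<lambda>i. e (Suc (Suc i))))"
    using def_term_shift[OF assms(3)] unfolding def_term_def .
  moreover have "def_pred (\<lambda>e. e 0 = r (\<lambda>i. e (Suc (Suc (Suc i)))))"
    using def_term_shift[OF def_term_shift[OF assms(4)]] unfolding def_term_def .
  ultimately have "def_pred (\<lambda>e. \<exists>x. x = t e \<and> (\<exists>y. y = s e \<and> (\<exists>z. z = r e \<and> Q x y z)))"
    using assms(2) unfolding def_term_def by (intro def_pred_ex def_pred_conj)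
  then show ?thesis by simp
qed

lemma def_term_subst1:
  assumes "def_term (\<lambda>e. F (e 0))" "def_term t"
  shows "def_term (\<lambda>e. F (t e))"
proof -
  have "def_pred (\<lambda>e. e 0 = F (e (Suc 0)))" using assms(1) unfolding def_term_def .
  then show ?thesis unfolding def_term_def
    by (rule def_pred_subst2[where Q = "\<lambda>v x. v = F x", OF _ def_term_var def_term_shift[OF assms(2)]])
qed

lemma def_term_subst2:
  assumes "def_term (\<lambda>e. F (e 0) (e (Suc 0)))" "def_term t" "def_term s"
  shows "def_term (\<lambda>e. F (t e) (s e))"
proof -
  have "def_pred (\<lambda>e. e 0 = F (e (Suc 0)) (e (Suc (Suc 0))))" using assms(1) unfolding def_term_def .
  then show ?thesis unfolding def_term_def
    by (rule def_pred_subst3[where Q = "\<lambda>v x y. v = F x y",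
          OF _ def_term_var def_term_shift[OF assms(2)] def_term_shift[OF assms(3)]])
qed

lemma class_fun_app: "class_fun f \<Longrightarrow> def_term t \<Longrightarrow> def_term (\<lambda>e. f (t e))"
  unfolding class_fun_def by (rule def_term_subst1)

lemma def_class_app: "def_class X \<Longrightarrow> def_term t \<Longrightarrow> def_pred (\<lambda>e. t e \<in> X)"
  unfolding def_class_def by (rule def_pred_subst1)

lemma def_pred_mem: "def_term t \<Longrightarrow> def_term s \<Longrightarrow> def_pred (\<lambda>e. t e \<in>\<^sub>V s e)"
  by (rule def_pred_subst2[where Q = "(\<in>\<^sub>V)", OF def_pred_mem_var])

lemma elts_iff: "y \<in> elts x \<longleftrightarrow> y \<in>\<^sub>V x"
  by (simp add: elts_def)

lemma def_pred_elts: "def_term t \<Longrightarrow> def_term s \<Longrightarrow> def_pred (\<lambda>e. t e \<in> elts (s e))"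
  by (simp add: elts_iff def_pred_mem)

lemma def_pred_eq: "def_term t \<Longrightarrow> def_term s \<Longrightarrow> def_pred (\<lambda>e. t e = s e)"
  by (rule def_pred_subst2[where Q = "(=)", OF def_pred_eq_var])

lemma def_pred_disj:
  assumes "def_pred P" "def_pred Q"
  shows "def_pred (\<lambda>e. P e \<or> Q e)"
proof -
  have "def_pred (\<lambda>e. \<not> (\<not> P e \<and> \<not> Q e))" using assms by (intro def_pred_not def_pred_conj)
  then show ?thesis by simp
qed

lemma def_pred_imp: "def_pred P \<Longrightarrow> def_pred Q \<Longrightarrow> def_pred (\<lambda>e. P e \<longrightarrow> Q e)"
  unfolding imp_conv_disj by (intro def_pred_disj def_pred_not)

lemma def_pred_iff: "def_pred P \<Longrightarrow> def_pred Q \<Longrightarrow> def_pred (\<lambda>e. P e \<longleftrightarrow> Q e)"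
  unfolding iff_conv_conj_imp by (intro def_pred_conj def_pred_imp)

lemma def_pred_all:
  assumes "def_pred (\<lambda>e. P (e 0) (\<lambda>i. e (Suc i)))"
  shows "def_pred (\<lambda>e. \<forall>x. P x e)"
proof -
  have "def_pred (\<lambda>e. \<not> (\<exists>x. \<not> P x e))" using assms by (intro def_pred_not def_pred_ex)
  then show ?thesis by simp
qed

lemma def_pred_bex:
  assumes "def_pred (\<lambda>e. e 0 \<in> X (\<lambda>i. e (Suc i)) \<and> P (e 0) (\<lambda>i. e (Suc i)))"
  shows "def_pred (\<lambda>e. \<exists>x\<in>X e. P x e)"
  unfolding Bex_def using assms by (rule def_pred_ex)

lemma def_pred_ball:
  assumes "def_pred (\<lambda>e. e 0 \<in> X (\<lambda>i. e (Suc i)) \<longrightarrow> P (e 0) (\<lambda>i. e (Suc i)))"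
  shows "def_pred (\<lambda>e. \<forall>x\<in>X e. P x e)"
  unfolding Ball_def using assms by (rule def_pred_all)

lemma def_pred_subset:
  assumes "def_pred (\<lambda>e. e 0 \<in> X (\<lambda>i. e (Suc i)) \<longrightarrow> e 0 \<in> Y (\<lambda>i. e (Suc i)))"
  shows "def_pred (\<lambda>e. X e \<subseteq> Y e)"
  unfolding subset_iff using assms by (rule def_pred_all)

lemma def_pred_set_eq:
  assumes "def_pred (\<lambda>e. e 0 \<in> X (\<lambda>i. e (Suc i)) \<longleftrightarrow> e 0 \<in> Y (\<lambda>i. e (Suc i)))"
  shows "def_pred (\<lambda>e. X e = Y e)"
  unfolding set_eq_iff using assms by (rule def_pred_all)

lemma def_pred_Int: "def_pred (\<lambda>e. t e \<in> X e) \<Longrightarrow> def_pred (\<lambda>e. t e \<in> Y e) \<Longrightarrow> def_pred (\<lambda>e. t e \<in> X e \<inter> Y e)"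
  unfolding Int_iff by (rule def_pred_conj)

lemma def_pred_Diff: "def_pred (\<lambda>e. t e \<in> X e) \<Longrightarrow> def_pred (\<lambda>e. t e \<in> Y e) \<Longrightarrow> def_pred (\<lambda>e. t e \<in> X e - Y e)"
  unfolding Diff_iff by (intro def_pred_conj def_pred_not)

lemma def_pred_image:
  "def_pred (\<lambda>e. \<exists>x\<in>X e. t e = f x e) \<Longrightarrow> def_pred (\<lambda>e. t e \<in> (\<lambda>x. f x e) ` X e)"
  unfolding image_iff .

lemma def_pred_Collect: "def_pred (\<lambda>e. P (t e) e) \<Longrightarrow> def_pred (\<lambda>e. t e \<in> {x. P x e})"
  by simp

lemma def_pred_UN: "def_pred (\<lambda>e. \<exists>x\<in>X e. t e \<in> Y x e) \<Longrightarrow> def_pred (\<lambda>e. t e \<in> (\<Union>x\<in>X e. Y x e))"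
  by simp

lemma def_pred_empty: "def_pred (\<lambda>e. t e \<in> {})"
  using def_pred_const[of False] by simp

lemma def_pred_insert:
  "def_pred (\<lambda>e. t e = s e) \<Longrightarrow> def_pred (\<lambda>e. t e \<in> X e) \<Longrightarrow> def_pred (\<lambda>e. t e \<in> insert (s e) (X e))"
  unfolding insert_iff by (rule def_pred_disj)

lemma def_term_if:
  assumes "def_pred P" "def_term t" "def_term s"
  shows "def_term (\<lambda>e. if P e then t e else s e)"
proof -
  have "def_pred (\<lambda>e. P (\<lambda>i. e (Suc i)))" using def_pred_reindex[OF assms(1), of Suc] by simp
  then have "def_pred (\<lambda>e. (P (\<lambda>i. e (Suc i)) \<longrightarrow> e 0 = t (\<lambda>i. e (Suc i))) \<and>
                 (\<not> P (\<lambda>i. e (Suc i)) \<longrightarrow> e 0 = s (\<lambda>i. e (Suc i))))"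
    using assms(2,3) unfolding def_term_def by (intro def_pred_conj def_pred_imp def_pred_not)
  then show ?thesis unfolding def_term_def
    by (rule back_subst[of def_pred]) (simp add: fun_eq_iff)
qed

lemmas def_pred_intros = def_pred_const def_term_const def_term_var def_pred_elts def_pred_eq def_pred_not def_pred_conj def_pred_disj
  def_pred_imp def_pred_iff def_pred_bex def_pred_ball def_pred_ex def_pred_all def_term_if
  def_pred_Int def_pred_Diff def_pred_image def_pred_Collect def_pred_UN def_pred_empty def_pred_insert

lemma def_termI:
  assumes "def_pred (\<lambda>e. P (e 0) (\<lambda>i. e (Suc i)))" "\<And>v e. v = t e \<longleftrightarrow> P v e"
  shows "def_term t"
  unfolding def_term_def assms(2) by (rule assms(1))

lemma def_class_sat:
  assumes "def_class X"
  obtains d p where "\<And>x. x \<in> X \<longleftrightarrow> sat (d(0 := x)) p"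
proof -
  obtain p s where p: "\<forall>e. e 0 \<in> X \<longleftrightarrow> sat (mix e s) p"
    using assms unfolding def_class_def def_pred_def by (elim exE)
  have "mix ((\<lambda>_. undefined)(0 := x)) s = (mix (\<lambda>_. undefined) s)(0 := x)" for x
    by (auto simp: fun_eq_iff mix_def)
  then have "x \<in> X \<longleftrightarrow> sat ((mix (\<lambda>_. undefined) s)(0 := x)) p" for x
    using spec[OF p, of "(\<lambda>_. undefined)(0 := x)"] by simp
  then show ?thesis by (rule that)
qed

lemma is_class_if_def_class:
  assumes "def_class X"
  shows "is_class X"
proof -
  obtain d p where "\<And>x. x \<in> X \<longleftrightarrow> sat (d(0 := x)) p" using def_class_sat[OF assms] by blast
  then have "X = {x. sat (d(0 := x)) p}" by auto
  then show ?thesis unfolding is_class_def by blast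
qed

end

section \<open>Set theory inside the model\<close>

context zfc
begin

lemma elts_set_of: "is_set X \<Longrightarrow> elts (set_of X) = X"
  unfolding is_set_def set_of_def using extensionality by (metis (mono_tags, lifting) the_equality)

lemma is_set_elts [simp]: "is_set (elts x)"
  unfolding is_set_def by auto

lemma set_of_elts [simp]: "set_of (elts x) = x"
  by (rule extensionality) (simp add: elts_set_of)

lemma eq_iff_elts: "x = y \<longleftrightarrow> elts x = elts y"
  using extensionality by blast

lemma eq_set_of: "is_set X \<Longrightarrow> v = set_of X \<longleftrightarrow> elts v = X"
  by (simp add: eq_iff_elts elts_set_of)

lemma is_set_Collect:
  assumes "def_pred (\<lambda>e. P (e 0))"
  shows "is_set {y \<in> elts x. P y}"
proof -
  have "def_class {y. P y}" using assms unfolding def_class_def by simp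
  then obtain d p where "\<And>y. y \<in> {y. P y} \<longleftrightarrow> sat (d(0 := y)) p" using def_class_sat by blast
  then show ?thesis using separation[of x d p] by simp
qed

lemma is_set_subset:
  assumes "def_class X" "X \<subseteq> elts x"
  shows "is_set X"
proof -
  have "X = {y \<in> elts x. y \<in> X}" using assms(2) by auto
  then show ?thesis using is_set_Collect[of "\<lambda>y. y \<in> X" x] assms(1) unfolding def_class_def by simp
qed

lemma is_set_image:
  assumes "class_fun f"
  shows "is_set (f ` elts x)"
proof -
  have "def_pred (\<lambda>e. e 0 = f (e (Suc 0)))" using assms unfolding class_fun_def def_term_def by simp
  then have "def_pred (\<lambda>e. e (Suc 0) = f (e 0))"
    by (rule def_pred_subst2[where Q = "\<lambda>v x. v = f x", OF _ def_term_var def_term_var])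
  then obtain p s where p: "\<forall>e. e (Suc 0) = f (e 0) \<longleftrightarrow> sat (mix e s) p"
    unfolding def_pred_def by (elim exE)
  \<comment> \<open>Replacement expects input and output at the variables 0 and 1, whereas the
    arguments 0 and 1 of \<open>mix\<close> are the variables 0 and 2; the swap reconciles the
    two.\<close>
  let ?f = "\<lambda>n::nat. if n = 1 then 2 else if n = 2 then 1 else n"
  have inj: "inj ?f" by (rule inj_on_inverseI[where g = ?f]) simp
  let ?d = "mix (\<lambda>_. undefined) s \<circ> ?f"
  have mix: "?d(0 := u, 1 := v) \<circ> ?f = mix ((\<lambda>_. undefined)(0 := u, Suc 0 := v)) s" for u v
    by (rule ext) (auto simp: mix_def elim!: evenE)
  have 1: "sat (?d(0 := u, 1 := v)) (rename ?f p) \<longleftrightarrow> v = f u" for u v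
    unfolding sat_rename[OF inj] mix
    using spec[OF p, of "(\<lambda>_. undefined)(0 := u, Suc 0 := v)"] by simp
  have "is_set {v. \<exists>u\<in>elts x. sat (?d(0 := u, 1 := v)) (rename ?f p)}"
    by (rule replacement) (unfold 1, blast)
  then show ?thesis unfolding 1 image_def .
qed

lemma is_set_UN: "is_set (\<Union>y\<in>elts x. elts y)"
  by (rule union)

lemma is_set_Pow: "is_set {y. elts y \<subseteq> elts x}"
  by (rule powerset)

lemma is_set_pair: "is_set {a, b}"
  by (rule pairing)

lemma is_set_singleton: "is_set {a}"
  using pairing[of a a] by simp

lemma is_set_Un: "is_set (elts a \<union> elts b)"
  using union[of "set_of {a, b}"] by (simp add: elts_set_of pairing)

lemma is_set_insert: "is_set (insert a (elts b))"
  using is_set_Un[of "set_of {a}" b] by (simp add: elts_set_of is_set_singleton)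

lemma is_set_empty: "is_set {}"
  using is_set_Collect[of "\<lambda>_. False" undefined] def_pred_const by simp

lemma elts_empty [simp]: "elts (set_of {}) = {}"
  by (simp add: elts_set_of is_set_empty)

lemma def_term_set_of:
  assumes "\<And>e. is_set (X e)" "def_pred (\<lambda>e. \<forall>y. y \<in> elts (e 0) \<longleftrightarrow> y \<in> X (\<lambda>i. e (Suc i)))"
  shows "def_term (\<lambda>e. set_of (X e))"
  unfolding def_term_def eq_set_of[OF assms(1)] set_eq_iff by (rule assms(2))

lemma def_term_opair0: "def_term (\<lambda>e. opair (e 0) (e (Suc 0)))"
proof -
  have pair: "def_term (\<lambda>e. set_of {e i, e j})" for i j
    by (intro def_term_set_of is_set_pair def_pred_intros)
  have single: "def_term (\<lambda>e. set_of {e i})" for i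
    by (intro def_term_set_of is_set_singleton def_pred_intros)
  show ?thesis unfolding opair_def
    by (rule def_term_subst2[where F = "\<lambda>a b. set_of {a, b}", OF pair single pair])
qed

lemmas def_term_opair = def_term_subst2[where F = opair, OF def_term_opair0]

lemma opair_inject [simp]: "opair a b = opair c d \<longleftrightarrow> a = c \<and> b = d"
proof
  assume "opair a b = opair c d"
  then have "{set_of {a}, set_of {a, b}} = {set_of {c}, set_of {c, d}}"
    unfolding opair_def using elts_set_of[OF is_set_pair] by metis
  moreover have "elts (set_of {u}) = {u}" "elts (set_of {u, v}) = {u, v}" for u v
    by (simp_all add: elts_set_of is_set_singleton is_set_pair)
  ultimately have "{{a}, {a, b}} = {{c}, {c, d}}"
    by (metis (no_types, lifting) image_empty image_insert)
  then show "a = c \<and> b = d" by (auto simp: doubleton_eq_iff)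
qed simp

lemma class_fun_graph: "class_fun f \<Longrightarrow> class_fun (\<lambda>a. opair a (f a))"
  unfolding class_fun_def by (intro def_term_opair def_term_var)

text \<open>Outside \<open>x\<close> the function \<open>f\<close> is an arbitrary function of HOL
  and may fail to be definable, so it is replaced there by a constant. On \<open>x\<close> its graph
  serves as a parameter.\<close>

lemma class_fun_restrict:
  assumes "is_set ((\<lambda>a. opair a (f a)) ` elts x)"
  shows "class_fun (\<lambda>a. if a \<in> elts x then f a else b)"
proof -
  let ?G = "set_of ((\<lambda>a. opair a (f a)) ` elts x)"
  have "def_pred (\<lambda>e. (e (Suc 0) \<in> elts x \<and> opair (e (Suc 0)) (e 0) \<in> elts ?G) \<or>
                 (e (Suc 0) \<notin> elts x \<and> e 0 = b))"
    by (intro def_pred_intros def_term_opair)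
  then show ?thesis unfolding class_fun_def
    by (rule def_termI[where P = "\<lambda>v e. (e 0 \<in> elts x \<and> opair (e 0) v \<in> elts ?G) \<or>
                 (e 0 \<notin> elts x \<and> v = b)"]) (auto simp: elts_set_of[OF assms])
qed

section \<open>Comparison of sizes by definable functions, and choice\<close>

lemma equinumerous_iff: "x \<approx>\<^sub>V y \<longleftrightarrow> (\<exists>f. class_fun f \<and> bij_betw f (elts x) (elts y))"
proof
  assume "x \<approx>\<^sub>V y"
  then obtain f where f: "bij_betw f (elts x) (elts y)" "is_set ((\<lambda>a. opair a (f a)) ` elts x)"
    unfolding equinumerous_def by blast
  have "bij_betw (\<lambda>a. if a \<in> elts x then f a else undefined) (elts x) (elts y)"
    using f(1) by (rule iffD1[OF bij_betw_cong, rotated]) simp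
  then show "\<exists>f. class_fun f \<and> bij_betw f (elts x) (elts y)" using class_fun_restrict[OF f(2)] by blast
qed (use equinumerous_def is_set_image class_fun_graph in blast)

lemma class_fun_inverse:
  assumes "class_fun f" "def_class X" "inj_on f X"
  obtains g where "class_fun g" "\<And>a. a \<in> X \<Longrightarrow> g (f a) = a"
proof -
  define g where "g b = (if \<exists>a\<in>X. f a = b then THE a. a \<in> X \<and> f a = b else undefined)" for b
  have 1: "g (f a) = a" if "a \<in> X" for a
    unfolding g_def using that assms(3) by (auto simp: inj_on_def intro!: the_equality)
  have "def_pred (\<lambda>e. (e 0 \<in> X \<and> f (e 0) = e (Suc 0)) \<or> ((\<forall>a\<in>X. f a \<noteq> e (Suc 0)) \<and> e 0 = undefined))"
    by (intro def_pred_intros class_fun_app[OF assms(1)] def_class_app[OF assms(2)])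
  moreover have "v = g b \<longleftrightarrow> (v \<in> X \<and> f v = b) \<or> ((\<forall>a\<in>X. f a \<noteq> b) \<and> v = undefined)" for v b
  proof (cases "\<exists>a\<in>X. f a = b")
    case True
    then obtain a where a: "a \<in> X" "f a = b" by blast
    then show ?thesis using 1 assms(3) by (auto simp: inj_on_def)
  next
    case False
    then show ?thesis by (auto simp: g_def)
  qed
  ultimately have "class_fun g" unfolding class_fun_def
    by (intro def_termI[where P = "\<lambda>v e. (v \<in> X \<and> f v = e 0) \<or> ((\<forall>a\<in>X. f a \<noteq> e 0) \<and> v = undefined)"])
  then show ?thesis using 1 that by blast
qed

lemma def_class_elts: "def_class (elts x)"
  unfolding def_class_def by (intro def_pred_intros)

lemma class_fun_comp: "class_fun f \<Longrightarrow> class_fun g \<Longrightarrow> class_fun (\<lambda>a. f (g a))"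
  unfolding class_fun_def by (rule def_term_subst1)

lemma class_fun_id: "class_fun (\<lambda>a. a)"
  unfolding class_fun_def by (rule def_term_var)

lemma eqv_refl: "x \<approx>\<^sub>V x"
  unfolding equinumerous_iff using class_fun_id bij_betw_id[unfolded id_def] by blast

lemma eqv_sym: "x \<approx>\<^sub>V y \<Longrightarrow> y \<approx>\<^sub>V x"
proof -
  assume "x \<approx>\<^sub>V y"
  then obtain f where f: "class_fun f" "bij_betw f (elts x) (elts y)" unfolding equinumerous_iff by blast
  obtain g where g: "class_fun g" "\<And>a. a \<in> elts x \<Longrightarrow> g (f a) = a"
    using class_fun_inverse[OF f(1) def_class_elts] f(2) bij_betw_def by metis
  have "bij_betw g (elts y) (elts x)"
    using g(2) by (intro bij_betw_byWitness[where f' = f])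
      (auto simp: bij_betw_imp_surj_on[OF f(2), symmetric])
  then show ?thesis unfolding equinumerous_iff using g(1) by blast
qed

lemma eqv_trans: "x \<approx>\<^sub>V y \<Longrightarrow> y \<approx>\<^sub>V z \<Longrightarrow> x \<approx>\<^sub>V z"
  unfolding equinumerous_iff using bij_betw_trans[unfolded comp_def] class_fun_comp by blast

text \<open>Comparison of sizes without reference to ordinals, available before cardinals are known
  to exist.\<close>

definition injects :: "'v \<Rightarrow> 'v \<Rightarrow> bool" where
  "injects x y \<longleftrightarrow> (\<exists>f. class_fun f \<and> inj_on f (elts x) \<and> f ` elts x \<subseteq> elts y)"

lemma injects_subset: "elts x \<subseteq> elts y \<Longrightarrow> injects x y"
  unfolding injects_def using class_fun_id inj_on_id[unfolded id_def] by (metis image_ident)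

lemma injects_eqv: "x \<approx>\<^sub>V y \<Longrightarrow> injects x y"
  unfolding injects_def equinumerous_iff bij_betw_def by blast

lemma injects_trans: "injects x y \<Longrightarrow> injects y z \<Longrightarrow> injects x z"
proof -
  assume "injects x y" "injects y z"
  then obtain f g where "class_fun f" "inj_on f (elts x)" "f ` elts x \<subseteq> elts y"
    "class_fun g" "inj_on g (elts y)" "g ` elts y \<subseteq> elts z" unfolding injects_def by blast
  then have "class_fun (\<lambda>a. g (f a))" "inj_on (\<lambda>a. g (f a)) (elts x)" "(\<lambda>a. g (f a)) ` elts x \<subseteq> elts z"
    using class_fun_comp by (auto simp: inj_on_def image_subset_iff)
  then show ?thesis unfolding injects_def by blast
qed

text \<open>\<open>Z\<close> is the least subset of \<open>x\<close> that contains the points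
  outside the range of \<open>g\<close> and is closed under \<open>f\<close> followed by
  \<open>g\<close>; the bijection is \<open>f\<close> on \<open>Z\<close> and the inverse of
  \<open>g\<close> elsewhere. Obtaining \<open>Z\<close> as an intersection of sets of the model,
  and not as a union of iterates, makes it definable without recursion.\<close>

lemma Schroeder_Bernstein_eqv:
  assumes "injects x y" "injects y x"
  shows "x \<approx>\<^sub>V y"
proof -
  obtain f where f: "class_fun f" "inj_on f (elts x)" "f ` elts x \<subseteq> elts y"
    using assms(1) unfolding injects_def by blast
  obtain g where g: "class_fun g" "inj_on g (elts y)" "g ` elts y \<subseteq> elts x"
    using assms(2) unfolding injects_def by blast
  obtain h where h: "class_fun h" "\<And>b. b \<in> elts y \<Longrightarrow> h (g b) = b"
    using class_fun_inverse[OF g(1) def_class_elts g(2)] by blast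
  define closed where
    "closed t \<longleftrightarrow> (\<forall>a\<in>elts x. a \<notin> g ` elts y \<or> (\<exists>b\<in>elts t. a = g (f b)) \<longrightarrow> a \<in> elts t)" for t
  define Z where "Z = {a \<in> elts x. \<forall>t. elts t \<subseteq> elts x \<and> closed t \<longrightarrow> a \<in> elts t}"
  have Zx: "Z \<subseteq> elts x" unfolding Z_def by blast
  have defZ: "def_class Z" unfolding def_class_def Z_def closed_def
    by (intro def_pred_intros def_pred_subset class_fun_app[OF f(1)] class_fun_app[OF g(1)])
  have setZ: "is_set Z" by (rule is_set_subset[OF defZ, of x]) (auto simp: Z_def)
  have closedZ: "a \<in> Z" if "a \<in> elts x" "a \<notin> g ` elts y \<or> (\<exists>b\<in>Z. a = g (f b))" for a
    using that unfolding Z_def closed_def by blast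
  \<comment> \<open>By minimality: a point with no such reason to belong to \<open>Z\<close> could
    be removed, leaving a smaller closed set.\<close>
  have Zunfold: "a \<notin> g ` elts y \<or> (\<exists>b\<in>Z. a = g (f b))" if "a \<in> Z" for a
  proof (rule ccontr)
    assume *: "\<not> ?thesis"
    let ?t = "set_of (Z - {a})"
    have "is_set (Z - {a})"
    proof (rule is_set_subset)
      show "def_class (Z - {a})" unfolding def_class_def by (intro def_pred_intros def_class_app[OF defZ])
    qed (auto simp: Z_def)
    then have t: "elts ?t = Z - {a}" by (rule elts_set_of)
    have "closed ?t" unfolding closed_def t using closedZ * by blast
    moreover have "elts ?t \<subseteq> elts x" unfolding t using Zx by blast
    ultimately have "a \<in> elts ?t" using that unfolding Z_def by blast
    then show False unfolding t by blast
  qed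
  let ?k = "\<lambda>a. if a \<in> Z then f a else h a"
  have class_fun: "class_fun ?k" unfolding class_fun_def
    by (intro def_pred_intros def_class_app[OF defZ] class_fun_app[OF f(1)] class_fun_app[OF h(1)])
  \<comment> \<open>Off \<open>Z\<close> a point is \<open>g b\<close> with \<open>b\<close> outside
    the image of \<open>Z\<close> under \<open>f\<close>; hence the two halves of \<open>?k\<close>
    have disjoint images.\<close>
  have out: "\<exists>b\<in>elts y. a = g b \<and> b \<notin> f ` Z" if "a \<in> elts x" "a \<notin> Z" for a
    using closedZ[OF that(1)] that(2) by blast
  have "inj_on ?k (elts x)"
  proof (rule inj_onI)
    fix a b assume ab: "a \<in> elts x" "b \<in> elts x" "?k a = ?k b"
    show "a = b"
    proof (cases "a \<in> Z"; cases "b \<in> Z")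
      assume "a \<in> Z" "b \<in> Z"
      then show ?thesis using ab f(2) by (auto dest: inj_onD)
    next
      assume "a \<in> Z" "b \<notin> Z"
      then show ?thesis using ab out[of b] h(2) by auto
    next
      assume "a \<notin> Z" "b \<in> Z"
      then show ?thesis using ab out[of a] h(2) by auto
    next
      assume "a \<notin> Z" "b \<notin> Z"
      then show ?thesis using ab out[of a] out[of b] h(2) by auto
    qed
  qed
  moreover have "?k a \<in> elts y" if "a \<in> elts x" for a
    using that out[of a] h(2) f(3) by auto
  moreover have "b \<in> ?k ` elts x" if "b \<in> elts y" for b
  proof (cases "g b \<in> Z")
    case True
    have "g b \<in> g ` elts y" using that by (rule imageI)
    with Zunfold[OF True] obtain a where a: "a \<in> Z" "g b = g (f a)" by blast
    have "b = f a" by (rule inj_onD[OF g(2) a(2) that]) (use a(1) Zx f(3) in blast)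
    then show ?thesis using \<open>a \<in> Z\<close> Zx by auto
  next
    case False
    then have "b = ?k (g b)" using h(2) that by simp
    moreover have "g b \<in> elts x" using g(3) that by blast
    ultimately show ?thesis by (rule image_eqI)
  qed
  ultimately have "bij_betw ?k (elts x) (elts y)" unfolding bij_betw_def by blast
  then show ?thesis unfolding equinumerous_iff using class_fun by blast
qed

text \<open>The axiom of choice of the model speaks of disjoint families; tagging each element of
  \<open>u\<close> with \<open>u\<close> itself makes the subsets of \<open>x\<close>
  disjoint.\<close>

lemma choice_function:
  obtains c where "class_fun c" "\<And>u. elts u \<subseteq> elts x \<Longrightarrow> elts u \<noteq> {} \<Longrightarrow> c u \<in> elts u"
proof -
  let ?tag = "\<lambda>u. set_of ((\<lambda>a. opair a u) ` elts u)"
  have tag1: "is_set ((\<lambda>a. opair a u) ` elts u)" for u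
    by (rule is_set_image) (unfold class_fun_def, intro def_pred_intros def_term_opair)
  have tag: "elts (?tag u) = (\<lambda>a. opair a u) ` elts u" for u
    by (rule elts_set_of[OF tag1])
  have "class_fun ?tag" unfolding class_fun_def by (intro def_term_set_of tag1 def_pred_intros def_term_opair)
  then have "is_set (?tag ` elts (set_of {u. elts u \<subseteq> elts x}))" by (rule is_set_image)
  then have "is_set (?tag ` {u. elts u \<subseteq> elts x})" by (simp add: elts_set_of is_set_Pow)
  then obtain F where F: "elts F = ?tag ` {u. elts u \<subseteq> elts x}" unfolding is_set_def by blast
  let ?F = "{v \<in> elts F. \<exists>a. a \<in> elts v}"
  have "is_set ?F" by (intro is_set_Collect def_pred_intros)
  then obtain F' where F': "elts F' = ?F" unfolding is_set_def by blast
  have "\<exists>c. \<forall>y\<in>elts F'. \<exists>!z. z \<in> elts c \<inter> elts y"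
  proof (rule choice)
    fix y z assume "y \<in> elts F'" "z \<in> elts F'" "y \<noteq> z"
    then show "elts y \<inter> elts z = {}" unfolding F' F by (auto simp: tag)
  qed (auto simp: F')
  then obtain C where C: "\<And>y. y \<in> elts F' \<Longrightarrow> \<exists>!z. z \<in> elts C \<inter> elts y" by blast
  \<comment> \<open>The uniqueness test with a default gives \<open>c\<close> a definable value
    everywhere, also where \<open>C\<close> does not single out an element.\<close>
  define c where "c u = (if \<exists>!a. a \<in> elts u \<and> opair a u \<in> elts C
                         then THE a. a \<in> elts u \<and> opair a u \<in> elts C else undefined)" for u
  have c: "v = c u \<longleftrightarrow> (v \<in> elts u \<and> opair v u \<in> elts C \<and>
             (\<forall>a\<in>elts u. opair a u \<in> elts C \<longrightarrow> a = v)) \<or>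
        (\<not> (\<exists>w\<in>elts u. opair w u \<in> elts C \<and> (\<forall>a\<in>elts u. opair a u \<in> elts C \<longrightarrow> a = w)) \<and> v = undefined)"
    for u v
  proof (cases "\<exists>!a. a \<in> elts u \<and> opair a u \<in> elts C")
    case True
    then show ?thesis unfolding c_def using theI'[OF True] by auto
  next
    case False
    then show ?thesis unfolding c_def by auto
  qed
  have "class_fun c" unfolding class_fun_def
    by (rule def_termI[where P = "\<lambda>v e. (v \<in> elts (e 0) \<and> opair v (e 0) \<in> elts C \<and>
             (\<forall>a\<in>elts (e 0). opair a (e 0) \<in> elts C \<longrightarrow> a = v)) \<or>
        (\<not> (\<exists>w\<in>elts (e 0). opair w (e 0) \<in> elts C \<and>
             (\<forall>a\<in>elts (e 0). opair a (e 0) \<in> elts C \<longrightarrow> a = w)) \<and> v = undefined)"])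
      (intro def_pred_intros def_term_opair, rule c)
  moreover have "c u \<in> elts u" if "elts u \<subseteq> elts x" "elts u \<noteq> {}" for u
  proof -
    have "?tag u \<in> elts F'" using that by (auto simp: F' F tag)
    then have "\<exists>!z. z \<in> elts C \<inter> elts (?tag u)" by (rule C)
    then obtain z where z: "z \<in> elts C" "z \<in> elts (?tag u)"
      and unique: "\<And>z'. z' \<in> elts C \<Longrightarrow> z' \<in> elts (?tag u) \<Longrightarrow> z' = z" by blast
    from z obtain a where a: "a \<in> elts u" "z = opair a u" unfolding tag by blast
    have ex: "\<exists>!a. a \<in> elts u \<and> opair a u \<in> elts C"
    proof (rule ex1I)
      show "a \<in> elts u \<and> opair a u \<in> elts C" using a z by simp
      show "b = a" if "b \<in> elts u \<and> opair b u \<in> elts C" for b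
        using unique[of "opair b u"] that unfolding tag a by auto
    qed
    then show ?thesis unfolding c_def using theI'[OF ex] by simp
  qed
  ultimately show ?thesis using that by blast
qed

end

context transitive_zfc_model
begin

section \<open>Ordinals, recursion and enumeration\<close>

lemma wf_mem: "wf {(a, b). a \<in> elts b}"
  using wellfounded unfolding wfp_def elts_iff .

text \<open>Well-foundedness seen from outside the model allows induction on arbitrary predicates,
  not only on definable ones.\<close>

lemma mem_induct [case_names mem]: "(\<And>b. (\<And>a. a \<in> elts b \<Longrightarrow> P a) \<Longrightarrow> P b) \<Longrightarrow> P b"
  using wf_induct_rule[OF wf_mem, of P b] by simp

lemma mem_least:
  assumes "P a"
  obtains m where "P m" "\<And>b. b \<in> elts m \<Longrightarrow> \<not> P b"
proof (rule ccontr)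
  assume "\<not> thesis"
  then have "\<not> P b" for b using that by (induction b rule: mem_induct) blast
  then show False using assms by blast
qed

lemma mem_irrefl: "x \<notin> elts x"
  by (induction x rule: mem_induct) blast

lemma ordinal_mem: "ordinal a \<Longrightarrow> b \<in> elts a \<Longrightarrow> ordinal b"
  unfolding ordinal_def by blast

lemma ordinal_trans: "ordinal a \<Longrightarrow> b \<in> elts a \<Longrightarrow> elts b \<subseteq> elts a"
  unfolding ordinal_def by blast

lemma ordinal_linear: "ordinal a \<Longrightarrow> ordinal b \<Longrightarrow> a \<in> elts b \<or> a = b \<or> b \<in> elts a"
proof (induction a arbitrary: b rule: mem_induct)
  case (mem a)
  note IH = mem.IH
  show ?case using mem.prems(2)
  proof (induction b rule: mem_induct)
    case (mem b)
    show ?case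
    proof (rule ccontr)
      assume *: "\<not> ?case"
      have "y \<in> elts a" if "y \<in> elts b" for y
        using mem.IH[OF that] ordinal_mem[OF mem.prems that] ordinal_trans[OF mem.prems that] that * by blast
      moreover have "x \<in> elts b" if "x \<in> elts a" for x
        using IH[OF that _ mem.prems] ordinal_mem[OF \<open>ordinal a\<close> that]
          ordinal_trans[OF \<open>ordinal a\<close> that] that * by blast
      ultimately have "a = b" by (intro extensionality) blast
      then show False using * by blast
    qed
  qed
qed

lemma ord_le_iff: "a \<le>\<^sub>V b \<longleftrightarrow> a \<in> elts b \<or> a = b"
  by (simp add: ord_le_def elts_iff)

lemma ord_le_refl: "a \<le>\<^sub>V a"
  by (simp add: ord_le_iff)

lemma ord_le_subset: "ordinal b \<Longrightarrow> a \<le>\<^sub>V b \<Longrightarrow> elts a \<subseteq> elts b"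
  unfolding ord_le_iff using ordinal_trans by blast

lemma ord_le_total: "ordinal a \<Longrightarrow> ordinal b \<Longrightarrow> a \<le>\<^sub>V b \<or> b \<in> elts a"
  unfolding ord_le_iff using ordinal_linear by blast

lemma ord_le_antisym: "ordinal a \<Longrightarrow> ordinal b \<Longrightarrow> a \<le>\<^sub>V b \<Longrightarrow> b \<le>\<^sub>V a \<Longrightarrow> a = b"
  using ord_le_subset extensionality by blast

lemma ord_le_trans: "ordinal c \<Longrightarrow> a \<le>\<^sub>V b \<Longrightarrow> b \<le>\<^sub>V c \<Longrightarrow> a \<le>\<^sub>V c"
  unfolding ord_le_iff using ordinal_trans by blast

lemma ord_le_mem_trans: "ordinal c \<Longrightarrow> a \<le>\<^sub>V b \<Longrightarrow> b \<in> elts c \<Longrightarrow> a \<in> elts c"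
  unfolding ord_le_iff using ordinal_trans by blast

lemma ordinal_set_of:
  assumes "is_set X" "\<And>b. b \<in> X \<Longrightarrow> ordinal b" "\<And>b. b \<in> X \<Longrightarrow> elts b \<subseteq> X"
  shows "ordinal (set_of X)"
  using assms unfolding ordinal_def elts_set_of[OF assms(1)] by blast

lemma def_pred_ordinal: "def_term t \<Longrightarrow> def_pred (\<lambda>e. ordinal (t e))"
proof (rule def_pred_subst1)
  show "def_pred (\<lambda>e. ordinal (e 0))" unfolding ordinal_def by (intro def_pred_intros def_pred_subset)
qed

text \<open>A second component lies two levels below its Kuratowski pair, so forming the union of
  \<open>g\<close> twice bounds the collection.\<close>

lemma is_set_range: "is_set {y. \<exists>z\<in>elts d. opair z y \<in> elts g}"
proof -
  obtain U where U: "elts U = (\<Union>y\<in>elts g. elts y)" using is_set_UN unfolding is_set_def by metis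
  obtain W where W: "elts W = (\<Union>y\<in>elts U. elts y)" using is_set_UN unfolding is_set_def by metis
  have "y \<in> elts W" if "opair z y \<in> elts g" for y z
  proof -
    have "set_of {z, y} \<in> elts (opair z y)" unfolding opair_def by (simp add: elts_set_of is_set_pair)
    then have "set_of {z, y} \<in> elts U" unfolding U using that by blast
    moreover have "y \<in> elts (set_of {z, y})" by (simp add: elts_set_of is_set_pair)
    ultimately show ?thesis unfolding W by blast
  qed
  then have "{y. \<exists>z\<in>elts d. opair z y \<in> elts g} \<subseteq> elts W" by blast
  then show ?thesis
    by (rule is_set_subset[rotated]) (unfold def_class_def, intro def_pred_intros def_term_opair)
qed

text \<open>Recursion in HOL provides the values but not their definability. The latter comes from
  attempts: a set \<open>g\<close> whose pairs over \<open>c\<close> obey the recursion agrees with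
  \<open>G\<close> there, and \<Phi> says that some attempt yields the value. Attempts exist by
  induction, each being a graph obtained by replacement from the shorter ones.\<close>

lemma ordinal_recursion:
  assumes H: "class_fun H"
  obtains G where "class_fun G" "\<And>b. ordinal b \<Longrightarrow> G b = H (set_of (G ` elts b))"
proof -
  define G where "G = wfrec {(a, b). a \<in> elts b} (\<lambda>g b. H (set_of (g ` elts b)))"
  have G: "G b = H (set_of (G ` elts b))" for b
  proof -
    have "cut G {(a, b). a \<in> elts b} b ` elts b = G ` elts b" by (auto simp: cut_def)
    moreover have "G b = H (set_of (cut G {(a, b). a \<in> elts b} b ` elts b))"
      unfolding G_def by (rule wfrec[OF wf_mem])
    ultimately show ?thesis by simp
  qed
  define R where "R g d = {y. \<exists>z\<in>elts d. opair z y \<in> elts g}" for g d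
  define val where "val g d b \<longleftrightarrow> (\<exists>u. elts u = R g d \<and> b = H u)" for g d b
  define att where "att g c \<longleftrightarrow> (\<forall>d\<in>elts c. \<forall>b. opair d b \<in> elts g \<longleftrightarrow> val g d b)" for g c
  define \<Phi> where "\<Phi> d v \<longleftrightarrow> (\<exists>g. att g d \<and> val g d v)" for d v
  have val: "val g d b \<longleftrightarrow> b = H (set_of (R g d))" for g d b
    unfolding val_def using is_set_range[of d g] unfolding R_def[symmetric]
    by (metis elts_set_of set_of_elts)
  have att: "opair d b \<in> elts g \<longleftrightarrow> b = G d" if "ordinal c" "att g c" "d \<in> elts c" for c g d b
    using that(3)
  proof (induction d arbitrary: b rule: mem_induct)
    case (mem d)
    have "elts d \<subseteq> elts c" using ordinal_trans that(1) mem.prems by blast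
    then have "R g d = G ` elts d" unfolding R_def using mem.IH by blast
    then show ?case using that(2) mem.prems G unfolding att_def val by metis
  qed
  have val_att: "val g c b \<longleftrightarrow> b = G c" if "ordinal c" "att g c" for c g b
  proof -
    have "R g c = G ` elts c" unfolding R_def using att[OF that] by blast
    then show ?thesis unfolding val using G by metis
  qed
  have def_pred_\<Phi>: "def_pred (\<lambda>e. \<Phi> (e i) (e j))" for i j
    unfolding \<Phi>_def att_def val_def R_def
    by (intro def_pred_intros def_pred_set_eq def_term_opair class_fun_app[OF H])
  have "\<exists>g. att g c" if "ordinal c" for c
    using that
  proof (induction c rule: mem_induct)
    case (mem c)
    have \<Phi>: "\<Phi> d v \<longleftrightarrow> v = G d" if "d \<in> elts c" for d v
      using mem.IH[OF that] ordinal_mem[OF mem.prems that] val_att unfolding \<Phi>_def by blast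
    let ?f = "\<lambda>d. if d \<in> elts c then G d else undefined"
    have "class_fun ?f" unfolding class_fun_def
      by (rule def_termI[where P = "\<lambda>v e. (e 0 \<in> elts c \<and> \<Phi> (e 0) v) \<or> (e 0 \<notin> elts c \<and> v = undefined)"])
        (intro def_pred_intros def_pred_\<Phi>, use \<Phi> in auto)
    then have "is_set ((\<lambda>d. opair d (?f d)) ` elts c)" by (intro is_set_image class_fun_graph)
    then obtain g where "elts g = (\<lambda>d. opair d (?f d)) ` elts c" unfolding is_set_def by blast
    then have g: "opair d b \<in> elts g \<longleftrightarrow> b = G d" if "d \<in> elts c" for d b
      using that by auto
    have "R g d = G ` elts d" if "d \<in> elts c" for d
      unfolding R_def using g ordinal_trans[OF mem.prems that] by blast
    then have "att g c" unfolding att_def val using g G by metis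
    then show ?case by blast
  qed
  then have \<Phi>: "\<Phi> d v \<longleftrightarrow> v = G d" if "ordinal d" for d v
    using val_att that unfolding \<Phi>_def by blast
  \<comment> \<open>Attempts determine \<open>G\<close> on ordinals only, so elsewhere it is
    replaced by a constant.\<close>
  let ?G = "\<lambda>d. if ordinal d then G d else undefined"
  have "class_fun ?G" unfolding class_fun_def
    by (rule def_termI[where P = "\<lambda>v e. (ordinal (e 0) \<and> \<Phi> (e 0) v) \<or> (\<not> ordinal (e 0) \<and> v = undefined)"])
      (intro def_pred_intros def_pred_\<Phi> def_pred_ordinal, use \<Phi> in auto)
  moreover have "?G b = H (set_of (?G ` elts b))" if "ordinal b" for b
  proof -
    have "?G ` elts b = G ` elts b" using ordinal_mem[OF that] by (intro image_cong) auto
    then show ?thesis using G[of b] that by simp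
  qed
  ultimately show ?thesis using that by blast
qed

text \<open>A new element is chosen at each stage until \<open>x\<close> is exhausted. The last
  conclusion records the choice made at each stage, because a suitable \<open>c\<close> prescribes
  the order of the enumeration; this is exploited for increasing unions.\<close>

lemma enumeration:
  assumes c: "class_fun c" "\<And>u. elts u \<subseteq> elts x \<Longrightarrow> elts u \<noteq> {} \<Longrightarrow> c u \<in> elts u"
  obtains \<theta> G where "ordinal \<theta>" "class_fun G" "bij_betw G (elts \<theta>) (elts x)"
    "\<And>b. b \<in> elts \<theta> \<Longrightarrow> \<exists>u. elts u = elts x - G ` elts b \<and> G b = c u"
proof -
  have diff: "is_set (elts x - elts u)" for u
    by (rule is_set_subset[where x = x]) (auto simp: def_class_def intro!: def_pred_intros)
  have H: "class_fun (\<lambda>u. c (set_of (elts x - elts u)))"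
    unfolding class_fun_def by (intro class_fun_app[OF c(1)] def_term_set_of diff def_pred_intros)
  obtain G where G: "class_fun G"
    "\<And>b. ordinal b \<Longrightarrow> G b = c (set_of (elts x - elts (set_of (G ` elts b))))"
    using ordinal_recursion[OF H] by blast
  have Gc: "\<exists>u. elts u = elts x - G ` elts b \<and> G b = c u" if "ordinal b" for b
    by (rule exI[of _ "set_of (elts x - elts (set_of (G ` elts b)))"], unfold elts_set_of[OF diff])
      (simp add: G(2)[OF that] elts_set_of[OF is_set_image[OF G(1)]])
  \<comment> \<open>Stages up to which elements remain. They form an initial segment of the
    ordinals, and \<open>G\<close> is injective on it.\<close>
  define good where
    "good b \<longleftrightarrow> ordinal b \<and> (\<forall>d. d \<in> elts b \<or> d = b \<longrightarrow> \<not> elts x \<subseteq> G ` elts d)" for b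
  have good_mem: "good d" if "good b" "d \<in> elts b" for b d
  proof -
    have "ordinal b" using that(1) unfolding good_def by (rule conjunct1)
    then have "ordinal d" "elts d \<subseteq> elts b" using that(2) ordinal_mem ordinal_trans by auto
    then show ?thesis using that unfolding good_def by (auto simp: subset_iff[of "elts d" "elts b"])
  qed
  have good_ord: "ordinal b" and good_self: "\<not> elts x \<subseteq> G ` elts b" if "good b" for b
    using that unfolding good_def by auto
  have Gb: "G b \<in> elts x - G ` elts b" if b: "good b" for b
  proof -
    obtain u where u: "elts u = elts x - G ` elts b" "G b = c u"
      using Gc[OF good_ord[OF b]] by blast
    then have "elts u \<noteq> {}" using good_self[OF b] by blast
    then show ?thesis using c(2)[of u] u by auto
  qed
  have inj: "inj_on G {b. good b}"
  proof (rule inj_onI)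
    fix a b assume ab: "a \<in> {b. good b}" "b \<in> {b. good b}" "G a = G b"
    then have "G a \<notin> G ` elts b" "G b \<notin> G ` elts a" using Gb[of a] Gb[of b] by auto
    then have "a \<notin> elts b" "b \<notin> elts a" by blast+
    moreover have "ordinal a" "ordinal b" using ab good_ord by auto
    ultimately show "a = b" using ordinal_linear by blast
  qed
  have def_class: "def_class {b. good b}" unfolding good_def def_class_def
    by (intro def_pred_intros def_pred_ordinal def_pred_subset class_fun_app[OF G(1)])
  obtain h where h: "class_fun h" "\<And>b. b \<in> {b. good b} \<Longrightarrow> h (G b) = b"
    using class_fun_inverse[OF G(1) def_class inj] by blast
  \<comment> \<open>As in Hartogs' argument: the good stages are the image under \<open>h\<close> of
    a subset of \<open>x\<close>, so by replacement they form a set \<theta>. This is an ordinal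
    that is not good itself, hence \<open>x\<close> is exhausted there.\<close>
  let ?A = "{v \<in> elts x. \<exists>b. good b \<and> G b = v}"
  have "is_set ?A" using def_class_app[OF def_class] by (intro is_set_Collect def_pred_intros class_fun_app[OF G(1)]) (simp add: def_term_var)
  then obtain A where A: "elts A = ?A" unfolding is_set_def by blast
  have "h ` elts A = {b. good b}" unfolding A using h(2) Gb by (force simp: image_iff)
  then have set: "is_set {b. good b}" using is_set_image[OF h(1), of A] by simp
  define \<theta> where "\<theta> = set_of {b. good b}"
  have \<theta>: "elts \<theta> = {b. good b}" unfolding \<theta>_def by (rule elts_set_of[OF set])
  have ord: "ordinal \<theta>" unfolding \<theta>_def
    by (rule ordinal_set_of[OF set]) (use good_ord good_mem in auto)
  have "\<not> good \<theta>" using mem_irrefl[of \<theta>] unfolding \<theta> by simp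
  then obtain d where d: "d \<in> elts \<theta> \<or> d = \<theta>" "elts x \<subseteq> G ` elts d" using ord unfolding good_def by auto
  then have "d \<notin> elts \<theta>" using good_self unfolding \<theta> by auto
  then have "elts x \<subseteq> G ` elts \<theta>" using d by blast
  then have "bij_betw G (elts \<theta>) (elts x)" unfolding bij_betw_def \<theta> using inj Gb by blast
  with ord G(1) show ?thesis by (rule that) (rule Gc[OF ordinal_mem[OF ord]])
qed

section \<open>Cardinals of sets\<close>

lemma cardinal_ordinal: "cardinal k \<Longrightarrow> ordinal k"
  by (simp add: cardinal_def)

lemma cardinal_unique: "cardinal k \<Longrightarrow> cardinal l \<Longrightarrow> k \<approx>\<^sub>V l \<Longrightarrow> k = l"
  using ordinal_linear eqv_sym unfolding cardinal_def by blast

lemma eqv_cardinal_ex: "\<exists>k. cardinal k \<and> k \<approx>\<^sub>V x"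
proof -
  obtain c where c: "class_fun c" "\<And>u. elts u \<subseteq> elts x \<Longrightarrow> elts u \<noteq> {} \<Longrightarrow> c u \<in> elts u"
    using choice_function by blast
  obtain \<theta> G where "ordinal \<theta>" "class_fun G" "bij_betw G (elts \<theta>) (elts x)"
    by (rule enumeration[OF c]) (assumption, assumption, rule that)
  then have "ordinal \<theta> \<and> \<theta> \<approx>\<^sub>V x" unfolding equinumerous_iff by blast
  then obtain k where k: "ordinal k \<and> k \<approx>\<^sub>V x"
    and least: "\<And>b. b \<in> elts k \<Longrightarrow> \<not> (ordinal b \<and> b \<approx>\<^sub>V x)"
    using mem_least[of "\<lambda>k. ordinal k \<and> k \<approx>\<^sub>V x"] by blast
  have "\<not> b \<approx>\<^sub>V k" if "b \<in> elts k" for b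
    using least[OF that] ordinal_mem k that eqv_trans by blast
  then show ?thesis using k unfolding cardinal_def by blast
qed

lemma vcard_eqI: "cardinal k \<Longrightarrow> k \<approx>\<^sub>V x \<Longrightarrow> vcard x = k"
  unfolding vcard_def using cardinal_unique eqv_trans eqv_sym by blast

lemma cardinal_vcard: "cardinal (vcard x)" and vcard_eqv: "vcard x \<approx>\<^sub>V x"
  using eqv_cardinal_ex[of x] vcard_eqI by blast+

lemma vcard_cardinal: "cardinal k \<Longrightarrow> vcard k = k"
  using vcard_eqI eqv_refl by blast

lemma ordinal_vcard: "ordinal (vcard x)"
  using cardinal_vcard cardinal_ordinal by blast

lemma vcard_cong: "x \<approx>\<^sub>V y \<Longrightarrow> vcard x = vcard y"
  by (rule vcard_eqI[OF cardinal_vcard eqv_trans[OF vcard_eqv eqv_sym]])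

lemma injects_vcard: "injects x (vcard x)" "injects (vcard x) x"
  by (rule injects_eqv, rule eqv_sym, rule vcard_eqv) (rule injects_eqv, rule vcard_eqv)

lemma injects_vcard_iff: "injects (vcard x) (vcard y) \<longleftrightarrow> injects x y"
proof
  assume "injects (vcard x) (vcard y)"
  then show "injects x y" by (rule injects_trans[OF injects_trans[OF injects_vcard(1)] injects_vcard(2)])
next
  assume "injects x y"
  then show "injects (vcard x) (vcard y)"
    by (rule injects_trans[OF injects_trans[OF injects_vcard(2)] injects_vcard(1)])
qed

lemma vcard_le_iff: "vcard x \<le>\<^sub>V vcard y \<longleftrightarrow> injects x y"
proof
  assume "vcard x \<le>\<^sub>V vcard y"
  then have "injects (vcard x) (vcard y)" by (intro injects_subset ord_le_subset ordinal_vcard)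
  then show "injects x y" by (simp only: injects_vcard_iff)
next
  assume xy: "injects x y"
  show "vcard x \<le>\<^sub>V vcard y"
  proof (rule ccontr)
    assume "\<not> vcard x \<le>\<^sub>V vcard y"
    then have less: "vcard y \<in> elts (vcard x)" using ord_le_total ordinal_vcard by blast
    then have "injects (vcard y) (vcard x)" using injects_subset ordinal_trans ordinal_vcard by blast
    then have "injects y x" by (simp only: injects_vcard_iff)
    then have "vcard x = vcard y" by (rule vcard_cong[OF Schroeder_Bernstein_eqv[OF xy]])
    then show False using less mem_irrefl[of "vcard x"] by simp
  qed
qed

lemma vcard_le_cardinal_iff: "cardinal k \<Longrightarrow> vcard x \<le>\<^sub>V k \<longleftrightarrow> injects x k"
  using vcard_le_iff[of x k] by (simp add: vcard_cardinal)

lemma cardinal_le_vcard_iff: "cardinal k \<Longrightarrow> k \<le>\<^sub>V vcard x \<longleftrightarrow> injects k x"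
  using vcard_le_iff[of k x] by (simp add: vcard_cardinal)

lemma vcard_less_iff:
  assumes "cardinal k"
  shows "vcard x \<in> elts k \<longleftrightarrow> \<not> injects k x"
proof -
  have "vcard x \<in> elts k \<longleftrightarrow> \<not> k \<le>\<^sub>V vcard x"
    using ord_le_total[of k "vcard x"] ord_le_mem_trans[of k k "vcard x"] mem_irrefl
      ordinal_vcard assms cardinal_ordinal by blast
  then show ?thesis using cardinal_le_vcard_iff[OF assms] by simp
qed

lemma injects_surj:
  assumes "class_fun f" "elts y \<subseteq> f ` elts x"
  shows "injects y x"
proof -
  obtain c where c: "class_fun c" "\<And>u. elts u \<subseteq> elts x \<Longrightarrow> elts u \<noteq> {} \<Longrightarrow> c u \<in> elts u"
    using choice_function by blast
  let ?S = "\<lambda>b. {a \<in> elts x. f a = b}"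
  have S: "is_set (?S b)" for b by (intro is_set_Collect def_pred_intros class_fun_app[OF assms(1)])
  let ?g = "\<lambda>b. c (set_of (?S b))"
  have "class_fun ?g" unfolding class_fun_def
    by (intro class_fun_app[OF c(1)] def_term_set_of S def_pred_intros class_fun_app[OF assms(1)])
  moreover have g: "?g b \<in> ?S b" if "b \<in> elts y" for b
    using c(2)[of "set_of (?S b)"] that assms(2) unfolding elts_set_of[OF S] by blast
  moreover have "inj_on ?g (elts y)"
    using g by (intro inj_on_inverseI[where g = f]) blast
  ultimately show ?thesis unfolding injects_def by blast
qed

text \<open>Equinumerosity is stated with functions of HOL. \<open>rel g x y\<close> replaces the
  function by a set \<open>g\<close> whose pairs between \<open>x\<close> and \<open>y\<close> form
  a bijection, which is expressible in the language.\<close>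

lemma def_pred_eqv: "def_term t \<Longrightarrow> def_term s \<Longrightarrow> def_pred (\<lambda>e. t e \<approx>\<^sub>V s e)"
proof (rule def_pred_subst2[where Q = "(\<approx>\<^sub>V)"])
  define rel where "rel g x y \<longleftrightarrow> (\<forall>a\<in>elts x. \<exists>b\<in>elts y. opair a b \<in> elts g) \<and>
     (\<forall>b\<in>elts y. \<exists>a\<in>elts x. opair a b \<in> elts g) \<and>
     (\<forall>a\<in>elts x. \<forall>b\<in>elts y. \<forall>a'\<in>elts x. \<forall>b'\<in>elts y.
        opair a b \<in> elts g \<and> opair a' b' \<in> elts g \<longrightarrow> (a = a' \<longleftrightarrow> b = b'))" for g x y
  have "x \<approx>\<^sub>V y \<longleftrightarrow> (\<exists>g. rel g x y)" for x y
  proof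
    assume "x \<approx>\<^sub>V y"
    then obtain f where f: "bij_betw f (elts x) (elts y)" "is_set ((\<lambda>a. opair a (f a)) ` elts x)"
      unfolding equinumerous_def by blast
    then obtain g where "elts g = (\<lambda>a. opair a (f a)) ` elts x" unfolding is_set_def by blast
    then have g: "opair a b \<in> elts g \<longleftrightarrow> a \<in> elts x \<and> b = f a" for a b by auto
    have y: "elts y = f ` elts x" and inj: "inj_on f (elts x)" using f(1) by (auto simp: bij_betw_def)
    have "rel g x y" unfolding rel_def g y using inj by (auto dest: inj_onD)
    then show "\<exists>g. rel g x y" by blast
  next
    assume "\<exists>g. rel g x y"
    then obtain g where g: "rel g x y" by blast
    define f where "f a = (if a \<in> elts x then THE b. b \<in> elts y \<and> opair a b \<in> elts g else undefined)" for a
    have f: "b = f a \<longleftrightarrow> b \<in> elts y \<and> opair a b \<in> elts g" if "a \<in> elts x" for a b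
    proof -
      have ex: "\<exists>!b. b \<in> elts y \<and> opair a b \<in> elts g" using g that unfolding rel_def by blast
      have f: "f a = (THE b. b \<in> elts y \<and> opair a b \<in> elts g)" unfolding f_def using that by simp
      show ?thesis unfolding f using theI'[OF ex] the1_equality[OF ex] by blast
    qed
    have f_out: "f a = undefined" if "a \<notin> elts x" for a using that unfolding f_def by simp
    have f_eq: "v = f a \<longleftrightarrow> (a \<in> elts x \<and> v \<in> elts y \<and> opair a v \<in> elts g) \<or>
        (a \<notin> elts x \<and> v = undefined)" for a v
      using f[of a v] f_out[of a] by (cases "a \<in> elts x") simp_all
    have "class_fun f" unfolding class_fun_def
      by (rule def_termI[where P = "\<lambda>v e. (e 0 \<in> elts x \<and> v \<in> elts y \<and> opair (e 0) v \<in> elts g) \<or>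
            (e 0 \<notin> elts x \<and> v = undefined)"])
        (intro def_pred_intros def_term_opair, rule f_eq)
    moreover have "bij_betw f (elts x) (elts y)"
      unfolding bij_betw_def
    proof
      show "inj_on f (elts x)"
      proof (rule inj_onI)
        fix a b assume ab: "a \<in> elts x" "b \<in> elts x" "f a = f b"
        then show "a = b" using f[OF ab(1), of "f a"] f[OF ab(2), of "f b"] g unfolding rel_def by blast
      qed
      show "f ` elts x = elts y"
      proof (intro set_eqI iffI)
        fix b assume "b \<in> f ` elts x"
        then show "b \<in> elts y" using f by blast
      next
        fix b assume b: "b \<in> elts y"
        then obtain a where "a \<in> elts x" "opair a b \<in> elts g" using g unfolding rel_def by blast
        then show "b \<in> f ` elts x" using f b by blast
      qed
    qed
    ultimately show "x \<approx>\<^sub>V y" unfolding equinumerous_iff by blast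
  qed
  then show "def_pred (\<lambda>e. e 0 \<approx>\<^sub>V e (Suc 0))"
    unfolding rel_def by (simp only:) (intro def_pred_intros def_term_opair)
qed

lemma def_pred_cardinal: "def_term t \<Longrightarrow> def_pred (\<lambda>e. cardinal (t e))"
proof (rule def_pred_subst1)
  show "def_pred (\<lambda>e. cardinal (e 0))" unfolding cardinal_def by (intro def_pred_intros def_pred_ordinal def_pred_eqv)
qed

lemma def_term_vcard: "def_term t \<Longrightarrow> def_term (\<lambda>e. vcard (t e))"
proof (rule def_term_subst1[where F = vcard])
  show "def_term (\<lambda>e. vcard (e 0))"
  proof (rule def_termI[where P = "\<lambda>v e. cardinal v \<and> v \<approx>\<^sub>V e 0"])
    show "v = vcard (e 0) \<longleftrightarrow> cardinal v \<and> v \<approx>\<^sub>V e 0" for v e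
      using cardinal_vcard vcard_eqv vcard_eqI by blast
  qed (intro def_pred_intros def_pred_cardinal def_pred_eqv)
qed

end

section \<open>Cardinal arithmetic below and at a regular cardinal\<close>

context transitive_zfc_model
begin

lemma is_set_Diff: "is_set (elts x - elts u)"
  by (rule is_set_subset[where x = x]) (auto simp: def_class_def intro!: def_pred_intros)

lemma is_set_Int: "is_set (elts x \<inter> elts u)"
  by (rule is_set_subset[where x = x]) (auto simp: def_class_def intro!: def_pred_intros)

lemma vcard_ordinal_le: "ordinal a \<Longrightarrow> vcard a \<le>\<^sub>V a"
  using ord_le_total[OF ordinal_vcard, of a a] cardinal_vcard[of a] eqv_sym[OF vcard_eqv, of a]
  unfolding cardinal_def by blast

text \<open>Needed for a cardinal above a given one, so that \<open>csucc\<close> denotes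
  something.\<close>

lemma Cantor: "\<not> injects (set_of {u. elts u \<subseteq> elts x}) x"
proof
  assume "injects (set_of {u. elts u \<subseteq> elts x}) x"
  then obtain f where f: "class_fun f" "inj_on f {u. elts u \<subseteq> elts x}" "f ` {u. elts u \<subseteq> elts x} \<subseteq> elts x"
    unfolding injects_def elts_set_of[OF is_set_Pow] by blast
  let ?D = "{a \<in> elts x. \<exists>u. elts u \<subseteq> elts x \<and> f u = a \<and> a \<notin> elts u}"
  have "is_set ?D" by (intro is_set_Collect def_pred_intros def_pred_subset class_fun_app[OF f(1)])
  then obtain d where d: "elts d = ?D" unfolding is_set_def by blast
  then have dx: "elts d \<subseteq> elts x" by blast
  then have fd: "f d \<in> elts x" using f(3) by blast
  have "u = d" if "elts u \<subseteq> elts x" "f u = f d" for u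
    using inj_onD[OF f(2)] that dx by simp
  then have "f d \<in> elts d \<longleftrightarrow> f d \<notin> elts d" unfolding d using fd dx d by blast
  then show False by blast
qed

section \<open>Successor cardinals and cardinal sums\<close>

lemma csucc:
  assumes "cardinal k"
  shows "cardinal (csucc k)" "k \<in> elts (csucc k)" "\<And>d. cardinal d \<Longrightarrow> k \<in> elts d \<Longrightarrow> csucc k \<le>\<^sub>V d"
proof -
  let ?P = "\<lambda>c. cardinal c \<and> k \<in> elts c"
  have "?P (vcard (set_of {u. elts u \<subseteq> elts k}))"
    using Cantor[of k] cardinal_vcard vcard_le_cardinal_iff[OF assms]
      ord_le_total[OF ordinal_vcard cardinal_ordinal[OF assms]] by blast
  then obtain c where c: "?P c" and min: "\<And>d. d \<in> elts c \<Longrightarrow> \<not> ?P d"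
    using mem_least[of ?P] by blast
  have least: "c \<le>\<^sub>V d" if "cardinal d" "k \<in> elts d" for d
    using ord_le_total[of c d] min[of d] that c cardinal_ordinal by blast
  have "csucc k = c"
    unfolding csucc_def
  proof (rule the_equality)
    fix c' assume c': "cardinal c' \<and> k \<in>\<^sub>V c' \<and> (\<forall>d. cardinal d \<and> k \<in>\<^sub>V d \<longrightarrow> c' \<le>\<^sub>V d)"
    have "c' \<le>\<^sub>V c" using c c' by (simp add: elts_iff)
    moreover have "c \<le>\<^sub>V c'" using c' by (intro least) (simp_all add: elts_iff)
    ultimately show "c' = c" using c c' by (intro ord_le_antisym cardinal_ordinal) simp_all
  qed (use c least elts_iff in blast)
  then show "cardinal (csucc k)" "k \<in> elts (csucc k)"
    "\<And>d. cardinal d \<Longrightarrow> k \<in> elts d \<Longrightarrow> csucc k \<le>\<^sub>V d"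
    using c least by simp_all
qed

lemma vcard_less_csucc_iff:
  assumes "cardinal k"
  shows "vcard x \<in> elts (csucc k) \<longleftrightarrow> injects x k"
proof -
  have o: "ordinal (csucc k)" "ordinal k" using csucc(1) assms cardinal_ordinal by auto
  have "vcard x \<in> elts (csucc k) \<longleftrightarrow> vcard x \<le>\<^sub>V k"
  proof
    assume *: "vcard x \<in> elts (csucc k)"
    have False if "k \<in> elts (vcard x)"
      using csucc(3)[OF assms cardinal_vcard that] * ord_le_mem_trans[OF o(1) _ *] mem_irrefl by blast
    then show "vcard x \<le>\<^sub>V k" using ord_le_total[OF ordinal_vcard o(2)] by blast
  qed (use ord_le_mem_trans[OF o(1)] csucc(2)[OF assms] in blast)
  then show ?thesis using vcard_le_cardinal_iff[OF assms] by simp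
qed

lemma eqv_image: "class_fun f \<Longrightarrow> inj_on f (elts x) \<Longrightarrow> set_of (f ` elts x) \<approx>\<^sub>V x"
  by (rule eqv_sym) (auto simp: equinumerous_iff elts_set_of is_set_image bij_betw_def)

lemma eqv_disjoint_Un:
  assumes "u \<approx>\<^sub>V u'" "v \<approx>\<^sub>V v'" "elts u \<inter> elts v = {}" "elts u' \<inter> elts v' = {}"
    and c: "elts c = elts u \<union> elts v" "elts c' = elts u' \<union> elts v'"
  shows "c \<approx>\<^sub>V c'"
proof -
  obtain f where f: "class_fun f" "bij_betw f (elts u) (elts u')" using assms(1) equinumerous_iff by blast
  obtain g where g: "class_fun g" "bij_betw g (elts v) (elts v')" using assms(2) equinumerous_iff by blast
  let ?h = "\<lambda>a. if a \<in> elts u then f a else g a"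
  have "class_fun ?h" unfolding class_fun_def by (intro def_pred_intros class_fun_app[OF f(1)] class_fun_app[OF g(1)])
  moreover have "bij_betw ?h (elts u) (elts u')"
    using f(2) by (rule iffD1[OF bij_betw_cong, rotated]) simp
  moreover have "bij_betw ?h (elts v) (elts v')"
    using g(2) by (rule iffD1[OF bij_betw_cong, rotated]) (use assms(3) in auto)
  ultimately have "bij_betw ?h (elts c) (elts c')" unfolding c using assms(4) by (intro bij_betw_combine)
  then show ?thesis unfolding equinumerous_iff using \<open>class_fun ?h\<close> by blast
qed

text \<open>The sum must be split inside a cardinal: tagged copies of \<open>a\<close> and
  \<open>b\<close> are disjoint, and a bijection carries their union onto its cardinal.\<close>

lemma cadd:
  "cardinal (cadd a b)"
  "\<exists>u v. elts u \<inter> elts v = {} \<and> elts u \<union> elts v = elts (cadd a b) \<and> u \<approx>\<^sub>V a \<and> v \<approx>\<^sub>V b"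
proof -
  let ?sum = "\<lambda>c. \<exists>u v. elts u \<inter> elts v = {} \<and> elts u \<union> elts v = elts c \<and> u \<approx>\<^sub>V a \<and> v \<approx>\<^sub>V b"
  let ?zero = "set_of {}"
  let ?one = "set_of {?zero}"
  have "elts ?one \<noteq> elts ?zero" by (simp add: elts_set_of is_set_singleton)
  then have ne: "?zero \<noteq> ?one" by metis
  have tag: "class_fun (\<lambda>x. opair x t)" for t unfolding class_fun_def by (intro def_term_opair def_pred_intros)
  let ?u = "set_of ((\<lambda>x. opair x ?zero) ` elts a)"
  let ?v = "set_of ((\<lambda>x. opair x ?one) ` elts b)"
  have uv: "?u \<approx>\<^sub>V a" "?v \<approx>\<^sub>V b" by (rule eqv_image[OF tag]; simp add: inj_on_def)+
  have disj: "elts ?u \<inter> elts ?v = {}" using ne by (auto simp: elts_set_of is_set_image[OF tag])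
  let ?D = "set_of (elts ?u \<union> elts ?v)"
  have D: "elts ?D = elts ?u \<union> elts ?v" by (rule elts_set_of[OF is_set_Un])
  obtain f where f: "class_fun f" "bij_betw f (elts ?D) (elts (vcard ?D))"
    using eqv_sym[OF vcard_eqv] equinumerous_iff by blast
  have im: "elts (set_of (f ` elts w)) = f ` elts w" for w by (rule elts_set_of[OF is_set_image[OF f(1)]])
  have inj: "inj_on f (elts ?u \<union> elts ?v)" using f(2) unfolding D by (simp add: bij_betw_def)
  have ex: "?sum (vcard ?D)"
  proof (intro exI conjI)
    show "elts (set_of (f ` elts ?u)) \<inter> elts (set_of (f ` elts ?v)) = {}"
      unfolding im using inj_on_image_Int[OF inj, of "elts ?u" "elts ?v"] disj by simp
    show "elts (set_of (f ` elts ?u)) \<union> elts (set_of (f ` elts ?v)) = elts (vcard ?D)"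
      unfolding im using f(2) unfolding D by (simp add: bij_betw_def image_Un)
    show "set_of (f ` elts ?u) \<approx>\<^sub>V a" "set_of (f ` elts ?v) \<approx>\<^sub>V b"
      by (rule eqv_trans[OF eqv_image[OF f(1)]], rule inj_on_subset[OF inj], simp, rule uv)+
  qed
  have unique: "c = c'" if c: "cardinal c" "?sum c" and c': "cardinal c'" "?sum c'" for c c'
  proof -
    obtain u v where 1: "elts u \<inter> elts v = {}" "elts u \<union> elts v = elts c" "u \<approx>\<^sub>V a" "v \<approx>\<^sub>V b"
      using c(2) by blast
    obtain u' v' where 2: "elts u' \<inter> elts v' = {}" "elts u' \<union> elts v' = elts c'" "u' \<approx>\<^sub>V a" "v' \<approx>\<^sub>V b"
      using c'(2) by blast
    have "c \<approx>\<^sub>V c'"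
      by (rule eqv_disjoint_Un[OF eqv_trans[OF 1(3) eqv_sym[OF 2(3)]] eqv_trans[OF 1(4) eqv_sym[OF 2(4)]]
            1(1) 2(1) 1(2)[symmetric] 2(2)[symmetric]])
    then show ?thesis by (rule cardinal_unique[OF c(1) c'(1)])
  qed
  have "cadd a b = vcard ?D"
    unfolding cadd_def by (rule the_equality) (use ex unique cardinal_vcard in blast)+
  then show "cardinal (cadd a b)" "?sum (cadd a b)" using cardinal_vcard ex by simp_all
qed

lemma le_cadd:
  assumes "cardinal k"
  shows "k \<le>\<^sub>V cadd a k"
proof -
  obtain v where v: "elts v \<subseteq> elts (cadd a k)" "v \<approx>\<^sub>V k" using cadd(2)[of a k] by blast
  then have "injects k (cadd a k)" using injects_trans injects_eqv eqv_sym injects_subset by blast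
  then show ?thesis using cardinal_le_vcard_iff[OF assms] vcard_cardinal[OF cadd(1)] by metis
qed

section \<open>Sets of size below a regular cardinal\<close>

context
  fixes k :: 'v
  assumes regular: "regular k"
begin

lemma regular_infinite: "infinite_cardinal k"
  using regular unfolding regular_def by (rule conjunct1)

lemma regular_cardinal: "cardinal k" and regular_nonempty: "elts k \<noteq> {}"
  and regular_limit: "a \<in> elts k \<Longrightarrow> \<exists>b\<in>elts k. a \<in> elts b"
  using regular_infinite by (simp_all add: infinite_cardinal_def elts_iff)

lemma regular_ordinal: "ordinal k"
  by (rule cardinal_ordinal[OF regular_cardinal])

lemma small_iff: "vcard x \<in> elts k \<longleftrightarrow> \<not> injects k x"
  by (rule vcard_less_iff[OF regular_cardinal])

lemma small_injects: "injects x y \<Longrightarrow> vcard y \<in> elts k \<Longrightarrow> vcard x \<in> elts k"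
  unfolding small_iff using injects_trans by blast

lemma small_subset: "elts x \<subseteq> elts y \<Longrightarrow> vcard y \<in> elts k \<Longrightarrow> vcard x \<in> elts k"
  using small_injects injects_subset by blast

lemma small_ordinal: "a \<in> elts k \<Longrightarrow> vcard a \<in> elts k"
  using ord_le_mem_trans[OF regular_ordinal vcard_ordinal_le] ordinal_mem[OF regular_ordinal] by blast

lemma small_empty: "elts x = {} \<Longrightarrow> vcard x \<in> elts k"
  unfolding small_iff injects_def using regular_nonempty by auto

lemma small_subsingleton:
  assumes "elts x \<subseteq> {a}"
  shows "vcard x \<in> elts k"
  unfolding small_iff
proof
  assume "injects k x"
  then obtain h where h: "inj_on h (elts k)" "h ` elts k \<subseteq> {a}" unfolding injects_def using assms by blast
  obtain b c where bc: "b \<in> elts k" "c \<in> elts k" "b \<in> elts c"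
    using regular_nonempty regular_limit by blast
  then have "h b = h c" using h(2) by blast
  then have "b = c" using h(1) bc by (auto dest: inj_onD)
  then show False using bc(3) mem_irrefl by blast
qed

lemma small_bounded: "elts x \<subseteq> elts k \<Longrightarrow> vcard x \<in> elts k \<Longrightarrow> \<exists>b\<in>elts k. \<forall>a\<in>elts x. a \<in> elts b"
  using regular by (simp add: regular_def elts_iff)

text \<open>The form of regularity by which injections of \<open>k\<close> into unions are refuted:
  the preimage of a small set is small, hence bounded.\<close>

lemma preimage_bounded:
  assumes "class_fun h" "inj_on h (elts k)" "vcard s \<in> elts k"
  shows "\<exists>b\<in>elts k. \<forall>a\<in>elts k. h a \<in> elts s \<longrightarrow> a \<in> elts b"
proof -
  have "is_set {a \<in> elts k. h a \<in> elts s}" by (intro is_set_Collect def_pred_intros class_fun_app[OF assms(1)])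
  then obtain p where p: "elts p = {a \<in> elts k. h a \<in> elts s}" unfolding is_set_def by blast
  have "inj_on h (elts p)" using assms(2) by (rule inj_on_subset) (use p in blast)
  then have "injects p s" unfolding injects_def using assms(1) p by blast
  then show ?thesis using small_bounded[of p] small_injects assms(3) p by blast
qed

text \<open>An injection of \<open>k\<close> would put every element of \<open>k\<close> below one
  of two bounds \<open>b\<close> and \<open>c\<close>, but the larger of them is below
  neither.\<close>

lemma small_Un:
  assumes "vcard x \<in> elts k" "vcard y \<in> elts k" "elts z \<subseteq> elts x \<union> elts y"
  shows "vcard z \<in> elts k"
  unfolding small_iff
proof
  assume "injects k z"
  then obtain h where h: "class_fun h" "inj_on h (elts k)" "h ` elts k \<subseteq> elts z" unfolding injects_def by blast
  obtain b where b: "b \<in> elts k" "\<forall>a\<in>elts k. h a \<in> elts x \<longrightarrow> a \<in> elts b"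
    using preimage_bounded[OF h(1,2) assms(1)] by blast
  obtain c where c: "c \<in> elts k" "\<forall>a\<in>elts k. h a \<in> elts y \<longrightarrow> a \<in> elts c"
    using preimage_bounded[OF h(1,2) assms(2)] by blast
  have o: "ordinal b" "ordinal c" using ordinal_mem[OF regular_ordinal] b c by blast+
  have *: "a \<in> elts b \<or> a \<in> elts c" if "a \<in> elts k" for a
    using that b c h(3) assms(3) by blast
  from ord_le_total[OF o] show False
  proof
    assume "b \<le>\<^sub>V c"
    then show False using *[OF c(1)] ord_le_subset[OF o(2)] mem_irrefl by blast
  next
    assume "c \<in> elts b"
    then show False using *[OF b(1)] ordinal_trans[OF o(1)] mem_irrefl by blast
  qed
qed

text \<open>Now every index \<open>i\<close> has its own least bound \<open>f i\<close>. These
  bounds form a small set, so they lie below a common \<open>b\<close>; but \<open>h b\<close>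
  belongs to some \<open>S i\<close>, which places \<open>b\<close> below \<open>f i\<close> and
  thus below itself.\<close>

lemma small_UN:
  assumes "vcard I \<in> elts k" "class_fun S" "\<And>i. i \<in> elts I \<Longrightarrow> vcard (S i) \<in> elts k"
    and T: "elts T \<subseteq> (\<Union>i\<in>elts I. elts (S i))"
  shows "vcard T \<in> elts k"
  unfolding small_iff
proof
  assume "injects k T"
  then obtain h where h: "class_fun h" "inj_on h (elts k)" "h ` elts k \<subseteq> elts T" unfolding injects_def by blast
  define bnd where "bnd i b \<longleftrightarrow> b \<in> elts k \<and> (\<forall>a\<in>elts k. h a \<in> elts (S i) \<longrightarrow> a \<in> elts b)" for i b
  \<comment> \<open>The intersection of all bounds: for ordinals this is the least bound, and it is
    visibly definable.\<close>
  define M where "M i = {a \<in> elts k. \<forall>b. bnd i b \<longrightarrow> a \<in> elts b}" for i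
  define f where "f i = set_of (M i)" for i
  have setM: "is_set (M i)" for i unfolding M_def bnd_def
    by (intro is_set_Collect def_pred_intros class_fun_app[OF h(1)])
  have class_fun: "class_fun f" unfolding f_def class_fun_def
    by (rule def_term_set_of[OF setM]) (unfold M_def bnd_def, intro def_pred_intros class_fun_app[OF h(1)] class_fun_app[OF assms(2)])
  have f: "bnd i (f i)" if "i \<in> elts I" for i
  proof -
    have "\<exists>b. bnd i b" using preimage_bounded[OF h(1,2) assms(3)[OF that]] unfolding bnd_def by blast
    then obtain b where b: "bnd i b" and least: "\<And>b'. b' \<in> elts b \<Longrightarrow> \<not> bnd i b'"
      using mem_least[of "bnd i"] by blast
    have ord: "ordinal b'" if "bnd i b'" for b'
      using that ordinal_mem[OF regular_ordinal] unfolding bnd_def by blast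
    have "b \<le>\<^sub>V b'" if "bnd i b'" for b'
      using ord_le_total[OF ord[OF b] ord[OF that]] least that by blast
    then have "elts b \<subseteq> elts b'" if "bnd i b'" for b' using ord_le_subset[OF ord[OF that]] that by blast
    moreover have "elts b \<subseteq> elts k" using b ordinal_trans[OF regular_ordinal] unfolding bnd_def by blast
    ultimately have "elts b = M i" using b unfolding M_def by blast
    then have "f i = b" unfolding f_def by (metis set_of_elts)
    then show ?thesis using b by simp
  qed
  let ?J = "set_of (f ` elts I)"
  have J: "elts ?J = f ` elts I" by (rule elts_set_of[OF is_set_image[OF class_fun]])
  have "vcard ?J \<in> elts k" using small_injects[OF injects_surj[OF class_fun]] J assms(1) by blast
  moreover have "elts ?J \<subseteq> elts k" unfolding J using f unfolding bnd_def by blast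
  ultimately obtain b where b: "b \<in> elts k" "\<forall>a\<in>elts ?J. a \<in> elts b" using small_bounded by blast
  have "h b \<in> elts T" using b(1) h(3) by blast
  then obtain i where i: "i \<in> elts I" "h b \<in> elts (S i)" using T by blast
  then have "b \<in> elts (f i)" using f[OF i(1)] b(1) unfolding bnd_def by blast
  moreover have "f i \<in> elts b" using b(2) i(1) unfolding J by blast
  ultimately have "b \<in> elts b" using ordinal_trans[OF ordinal_mem[OF regular_ordinal b(1)]] by blast
  then show False using mem_irrefl by blast
qed

text \<open>Enumerate \<open>T\<close> so that elements of earlier \<open>F a\<close> come first; proper initial segments of the enumeration are small.\<close>

lemma small_increasing_UN_injects:
  assumes F: "class_fun F" "\<And>a. a \<in> elts k \<Longrightarrow> vcard (F a) \<in> elts k"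
    and mono: "\<And>a b. b \<in> elts k \<Longrightarrow> a \<in> elts b \<Longrightarrow> elts (F a) \<subseteq> elts (F b)"
    and T: "elts T = (\<Union>a\<in>elts k. elts (F a))"
  shows "injects T k"
proof -
  obtain c0 where c0: "class_fun c0" "\<And>u. elts u \<subseteq> elts T \<Longrightarrow> elts u \<noteq> {} \<Longrightarrow> c0 u \<in> elts u"
    using choice_function by blast
  \<comment> \<open>\<open>lev u a\<close> says that no \<open>F b\<close> before \<open>F a\<close>
    meets \<open>u\<close>, so \<open>L u\<close> is the part of \<open>u\<close> inside the first
    \<open>F a\<close> that meets \<open>u\<close>.\<close>
  define lev where "lev u a \<longleftrightarrow> a \<in> elts k \<and> (\<forall>b\<in>elts a. elts u \<inter> elts (F b) = {})" for u a
  define L where "L u = {t \<in> elts u. \<exists>a. lev u a \<and> t \<in> elts (F a)}" for u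
  have setL: "is_set (L u)" for u unfolding L_def lev_def
    by (intro is_set_Collect def_pred_intros def_pred_set_eq class_fun_app[OF F(1)])
  define c where "c u = c0 (set_of (L u))" for u
  have DFc: "class_fun c" unfolding class_fun_def c_def
    by (rule class_fun_app[OF c0(1) def_term_set_of[OF setL]])
      (unfold L_def lev_def, intro def_pred_intros def_pred_set_eq class_fun_app[OF F(1)])
  have cL: "c u \<in> L u" if "elts u \<subseteq> elts T" "elts u \<noteq> {}" for u
  proof -
    have "\<exists>a. a \<in> elts k \<and> elts u \<inter> elts (F a) \<noteq> {}" using that T by blast
    then obtain a where a: "a \<in> elts k \<and> elts u \<inter> elts (F a) \<noteq> {}"
      and least: "\<And>b. b \<in> elts a \<Longrightarrow> \<not> (b \<in> elts k \<and> elts u \<inter> elts (F b) \<noteq> {})"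
      using mem_least[of "\<lambda>a. a \<in> elts k \<and> elts u \<inter> elts (F a) \<noteq> {}"] by blast
    have "lev u a" unfolding lev_def using a least ordinal_trans[OF regular_ordinal] by blast
    then have "L u \<noteq> {}" unfolding L_def using a by blast
    moreover have "L u \<subseteq> elts T" unfolding L_def using that(1) by blast
    ultimately show ?thesis unfolding c_def using c0(2)[of "set_of (L u)"] elts_set_of[OF setL] by simp
  qed
  then have c: "c u \<in> elts u" if "elts u \<subseteq> elts T" "elts u \<noteq> {}" for u
    using that unfolding L_def by blast
  obtain \<theta> G where \<theta>: "ordinal \<theta>" and G: "class_fun G" "bij_betw G (elts \<theta>) (elts T)"
    and step: "\<And>b. b \<in> elts \<theta> \<Longrightarrow> \<exists>u. elts u = elts T - G ` elts b \<and> G b = c u"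
    by (rule enumeration[OF DFc c]) (assumption, assumption, rule that)
  have inj: "inj_on G (elts \<theta>)" and GT: "\<And>b. b \<in> elts \<theta> \<Longrightarrow> G b \<in> elts T"
    using G(2) by (auto simp: bij_betw_def)
  have lev: "\<exists>a. a \<in> elts k \<and> G b \<in> elts (F a) \<and> (\<forall>a'\<in>elts a. (elts T - G ` elts b) \<inter> elts (F a') = {})"
    if b: "b \<in> elts \<theta>" for b
  proof -
    obtain u where u: "elts u = elts T - G ` elts b" "G b = c u" using step[OF b] by blast
    have "b \<notin> elts b" "elts b \<subseteq> elts \<theta>" using mem_irrefl ordinal_trans[OF \<theta> b] by auto
    then have "G b \<notin> G ` elts b" using inj b by (auto dest: inj_onD)
    then have "elts u \<noteq> {}" using GT[OF b] u by blast
    then have "G b \<in> L u" using cL[of u] u by auto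
    then show ?thesis unfolding L_def lev_def u(1) by blast
  qed
  have "b \<in> elts k" if b: "b \<in> elts \<theta>" for b
  proof -
    obtain a where a: "a \<in> elts k" "G b \<in> elts (F a)" using lev[OF b] by blast
    have sub: "elts b \<subseteq> elts \<theta>" using ordinal_trans[OF \<theta> b] .
    \<comment> \<open>When an earlier \<open>G d\<close> was chosen, \<open>G b\<close> was still
      available. So the first level at that time was no later than \<open>a\<close>, and
      \<open>F\<close> increases.\<close>
    have "G ` elts b \<subseteq> elts (F a)"
    proof
      fix t assume "t \<in> G ` elts b"
      then obtain d where d: "d \<in> elts b" "t = G d" by blast
      then have d\<theta>: "d \<in> elts \<theta>" using sub by blast
      obtain a' where a': "a' \<in> elts k" "G d \<in> elts (F a')"
        "\<forall>a''\<in>elts a'. (elts T - G ` elts d) \<inter> elts (F a'') = {}" using lev[OF d\<theta>] by blast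
      have "b \<notin> elts d" using ordinal_trans[OF ordinal_mem[OF \<theta> b]] d(1) mem_irrefl by blast
      then have "G b \<notin> G ` elts d" using inj b ordinal_trans[OF \<theta> d\<theta>] by (auto dest: inj_onD)
      then have "a \<notin> elts a'" using a' GT[OF b] a(2) by blast
      then have "a' \<le>\<^sub>V a" using ord_le_total ordinal_mem[OF regular_ordinal] a(1) a'(1) by blast
      then have "elts (F a') \<subseteq> elts (F a)" unfolding ord_le_iff using mono[OF a(1)] by blast
      then show "t \<in> elts (F a)" using a'(2) d(2) by blast
    qed
    moreover have "inj_on G (elts b)" using inj sub by (rule inj_on_subset)
    ultimately have "injects b (F a)" unfolding injects_def using G(1) by blast
    then have "\<not> injects k b" using small_injects F(2)[OF a(1)] small_iff by blast
    then show ?thesis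
      using ord_le_total[OF regular_ordinal ordinal_mem[OF \<theta> b]] ord_le_subset[OF ordinal_mem[OF \<theta> b]]
        injects_subset by blast
  qed
  then have "injects \<theta> k" by (intro injects_subset) blast
  moreover have "injects T \<theta>" using G by (intro injects_eqv eqv_sym[of \<theta>]) (auto simp: equinumerous_iff)
  ultimately show ?thesis using injects_trans by blast
qed

section \<open>Unions of fewer than \<kappa> sets of size at most \<kappa>\<close>

lemma is_set_Times: "is_set {opair a b |a b. a \<in> elts x \<and> b \<in> elts y}"
proof -
  let ?row = "\<lambda>a. set_of ((\<lambda>b. opair a b) ` elts y)"
  have row: "is_set ((\<lambda>b. opair a b) ` elts y)" for a
    by (rule is_set_image) (unfold class_fun_def, intro def_term_opair def_pred_intros)
  have "class_fun ?row" unfolding class_fun_def by (intro def_term_set_of row def_pred_intros def_term_opair)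
  then have "is_set (?row ` elts x)" by (rule is_set_image)
  then obtain R where R: "elts R = ?row ` elts x" unfolding is_set_def by blast
  have "(\<Union>r\<in>elts R. elts r) = {opair a b |a b. a \<in> elts x \<and> b \<in> elts y}"
    unfolding R using elts_set_of[OF row] by auto
  then show ?thesis using is_set_UN[of R] by simp
qed

text \<open>For each \<open>s\<close> an injection into \<open>k\<close> is chosen, as a set of
  pairs \<gamma> s. The points sent below \<open>a\<close> by some \<gamma> s form a small set
  \<open>F a\<close>, by two small unions of sets with at most one point, and the sets
  \<open>F a\<close> increase to the whole union. No pairing function on \<open>k\<close> is
  involved.\<close>

lemma small_Union_injects:
  assumes "vcard S \<in> elts k" "\<And>s. s \<in> elts S \<Longrightarrow> injects s k"
    and T: "elts T \<subseteq> (\<Union>s\<in>elts S. elts s)"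
  shows "injects T k"
proof -
  obtain U where U: "elts U = (\<Union>s\<in>elts S. elts s)" using is_set_UN unfolding is_set_def by metis
  obtain W where W: "elts W = {opair a b |a b. a \<in> elts U \<and> b \<in> elts k}"
    using is_set_Times unfolding is_set_def by metis
  define PW where "PW = set_of {g. elts g \<subseteq> elts W}"
  have PW: "elts PW = {g. elts g \<subseteq> elts W}" unfolding PW_def by (rule elts_set_of[OF is_set_Pow])
  \<comment> \<open>\<open>g\<close> need not be single valued. That each point of \<open>s\<close>
    has a value makes the sets \<open>F a\<close> exhaust the union; that no two points share a
    value makes \<open>P s b\<close> small.\<close>
  define ing where "ing s g \<longleftrightarrow> (\<forall>t\<in>elts s. \<exists>b\<in>elts k. opair t b \<in> elts g) \<and>
     (\<forall>t\<in>elts s. \<forall>t'\<in>elts s. \<forall>b. opair t b \<in> elts g \<and> opair t' b \<in> elts g \<longrightarrow> t = t')" for s g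
  have ing_ex: "\<exists>g. elts g \<subseteq> elts W \<and> ing s g" if s: "s \<in> elts S" for s
  proof -
    obtain f where f: "class_fun f" "inj_on f (elts s)" "f ` elts s \<subseteq> elts k"
      using assms(2)[OF s] unfolding injects_def by blast
    obtain g where g: "elts g = (\<lambda>a. opair a (f a)) ` elts s"
      using is_set_image[OF class_fun_graph[OF f(1)]] unfolding is_set_def by metis
    have iff: "opair a b \<in> elts g \<longleftrightarrow> a \<in> elts s \<and> b = f a" for a b unfolding g by auto
    have "ing s g" unfolding ing_def iff using f(2,3) by (auto dest: inj_onD)
    moreover have "elts g \<subseteq> elts W" unfolding g W U using s f(3) by auto
    ultimately show ?thesis by blast
  qed
  obtain c where c: "class_fun c" "\<And>u. elts u \<subseteq> elts PW \<Longrightarrow> elts u \<noteq> {} \<Longrightarrow> c u \<in> elts u"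
    using choice_function by blast
  have setI: "is_set {g \<in> elts PW. ing s g}" for s
    unfolding ing_def by (intro is_set_Collect def_pred_intros def_term_opair)
  define \<gamma> where "\<gamma> s = c (set_of {g \<in> elts PW. ing s g})" for s
  have class_fun\<gamma>: "class_fun \<gamma>" unfolding \<gamma>_def class_fun_def
    by (rule class_fun_app[OF c(1) def_term_set_of[OF setI]]) (unfold ing_def, intro def_pred_intros def_term_opair)
  have \<gamma>: "ing s (\<gamma> s)" if s: "s \<in> elts S" for s
  proof -
    obtain g where "g \<in> elts PW" "ing s g" using ing_ex[OF s] unfolding PW by blast
    then have "\<gamma> s \<in> {g \<in> elts PW. ing s g}" unfolding \<gamma>_def
      using c(2)[of "set_of {g \<in> elts PW. ing s g}"] unfolding elts_set_of[OF setI] by blast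
    then show ?thesis by blast
  qed
  define P where "P s b = {t \<in> elts s. opair t b \<in> elts (\<gamma> s)}" for s b
  define Q where "Q s a = {t \<in> elts s. \<exists>b\<in>elts a. opair t b \<in> elts (\<gamma> s)}" for s a
  define F where "F a = {t \<in> elts U. \<exists>s\<in>elts S. t \<in> elts s \<and> (\<exists>b\<in>elts a. opair t b \<in> elts (\<gamma> s))}" for a
  have setP: "is_set (P s b)" for s b unfolding P_def by (intro is_set_Collect def_pred_intros def_term_opair)
  have setQ: "is_set (Q s a)" for s a unfolding Q_def by (intro is_set_Collect def_pred_intros def_term_opair)
  have setF: "is_set (F a)" for a
    unfolding F_def by (intro is_set_Collect def_pred_intros def_term_opair class_fun_app[OF class_fun\<gamma>])
  have smallP: "vcard (set_of (P s b)) \<in> elts k" if "s \<in> elts S" for s b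
  proof (cases "P s b = {}")
    case True
    then show ?thesis by (intro small_empty) simp
  next
    case False
    then obtain t where t: "t \<in> P s b" by blast
    have "P s b \<subseteq> {t}" using t \<gamma>[OF that] unfolding P_def ing_def by blast
    then show ?thesis by (intro small_subsingleton[of _ t]) (simp add: elts_set_of[OF setP])
  qed
  have smallQ: "vcard (set_of (Q s a)) \<in> elts k" if "s \<in> elts S" "a \<in> elts k" for s a
  proof (rule small_UN[of a "\<lambda>b. set_of (P s b)"])
    show "class_fun (\<lambda>b. set_of (P s b))" unfolding class_fun_def
      by (rule def_term_set_of[OF setP]) (unfold P_def, intro def_pred_intros def_term_opair)
    show "elts (set_of (Q s a)) \<subseteq> (\<Union>b\<in>elts a. elts (set_of (P s b)))"
      unfolding elts_set_of[OF setP] elts_set_of[OF setQ] unfolding P_def Q_def by blast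
  qed (rule small_ordinal[OF that(2)], rule smallP[OF that(1)])
  have smallF: "vcard (set_of (F a)) \<in> elts k" if "a \<in> elts k" for a
  proof (rule small_UN[of S "\<lambda>s. set_of (Q s a)"])
    show "class_fun (\<lambda>s. set_of (Q s a))" unfolding class_fun_def
      by (rule def_term_set_of[OF setQ]) (unfold Q_def, intro def_pred_intros def_term_opair class_fun_app[OF class_fun\<gamma>])
    show "elts (set_of (F a)) \<subseteq> (\<Union>s\<in>elts S. elts (set_of (Q s a)))"
      unfolding elts_set_of[OF setF] elts_set_of[OF setQ] unfolding F_def Q_def by blast
  qed (rule assms(1), rule smallQ[OF _ that])
  have "injects U k"
  proof (rule small_increasing_UN_injects)
    show "class_fun (\<lambda>a. set_of (F a))" unfolding class_fun_def
      by (rule def_term_set_of[OF setF]) (unfold F_def, intro def_pred_intros def_term_opair class_fun_app[OF class_fun\<gamma>])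
    show "vcard (set_of (F a)) \<in> elts k" if "a \<in> elts k" for a by (rule smallF[OF that])
    show "elts (set_of (F a)) \<subseteq> elts (set_of (F b))" if "b \<in> elts k" "a \<in> elts b" for a b
    proof -
      have "elts a \<subseteq> elts b" using ordinal_trans[OF ordinal_mem[OF regular_ordinal that(1)] that(2)] .
      then show ?thesis unfolding elts_set_of[OF setF] unfolding F_def by blast
    qed
    have "\<exists>a\<in>elts k. t \<in> F a" if t: "t \<in> elts U" for t
    proof -
      obtain s where s: "s \<in> elts S" "t \<in> elts s" using t U by blast
      then obtain b where "b \<in> elts k" "opair t b \<in> elts (\<gamma> s)" using \<gamma>[OF s(1)] unfolding ing_def by blast
      moreover obtain a where "a \<in> elts k" "b \<in> elts a" using regular_limit calculation(1) by blast
      ultimately show ?thesis unfolding F_def using s t by blast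
    qed
    then show "elts U = (\<Union>a\<in>elts k. elts (set_of (F a)))"
      unfolding elts_set_of[OF setF] using F_def by blast
  qed
  moreover have "injects T U" using T U by (intro injects_subset) simp
  ultimately show ?thesis using injects_trans by blast
qed

lemma small_le: "vcard x \<in> elts k \<Longrightarrow> injects x k"
  unfolding vcard_le_cardinal_iff[OF regular_cardinal, symmetric] ord_le_iff by blast

lemma Un_injects:
  assumes "injects x k" "injects y k" "elts z \<subseteq> elts x \<union> elts y"
  shows "injects z k"
proof -
  have e: "elts (set_of {x, y}) = {x, y}" by (rule elts_set_of[OF is_set_pair])
  have "vcard (set_of {x, y}) \<in> elts k"
    by (rule small_Un[of "set_of {x}" "set_of {y}"])
      (auto intro!: small_subsingleton simp: e elts_set_of is_set_singleton)
  then show ?thesis by (rule small_Union_injects) (use assms e in auto)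
qed

text \<open>Simplifies the labels (c) and (wf): for \<open>x\<close> of size at most
  \<open>k\<close> their bound is \<open>k\<close> itself.\<close>

lemma cadd_absorb:
  assumes "injects x k"
  shows "cadd (vcard x) k = k"
proof -
  obtain u v where uv: "elts u \<union> elts v = elts (cadd (vcard x) k)" "u \<approx>\<^sub>V vcard x" "v \<approx>\<^sub>V k"
    using cadd(2) by blast
  have "injects u k" using injects_trans[OF injects_eqv[OF eqv_trans[OF uv(2) vcard_eqv]] assms] .
  then have "injects (cadd (vcard x) k) k" using injects_eqv[OF uv(3)] uv(1) Un_injects by blast
  then have "cadd (vcard x) k \<le>\<^sub>V k"
    using vcard_le_cardinal_iff[OF regular_cardinal, of "cadd (vcard x) k"] vcard_cardinal[OF cadd(1)] by simp
  then show ?thesis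
    using le_cadd[OF regular_cardinal] ord_le_antisym cardinal_ordinal[OF cadd(1)] regular_ordinal by blast
qed

end

end

section \<open>Covering families and the derived functor\<close>

context transitive_zfc_model
begin

lemma small_Diff_self: "regular k \<Longrightarrow> vcard (set_of (elts x - elts x)) \<in> elts k"
  by (rule small_empty) simp_all

lemma covering_family_iff:
  assumes "cardinal k"
  shows "covering_family l (csucc k) (csucc k) k X \<longleftrightarrow>
    (\<forall>x\<in>elts X. elts x \<subseteq> elts l \<and> injects x k) \<and>
    (\<forall>y. elts y \<subseteq> elts l \<and> injects y k \<longrightarrow>
       (\<exists>S. elts S \<subseteq> elts X \<and> vcard S \<in> elts k \<and> elts y \<subseteq> (\<Union>x\<in>elts S. elts x)))"
  unfolding covering_family_def
  by (simp only: elts_iff[of _ "csucc k", symmetric] elts_iff[of _ k, symmetric] vcard_less_csucc_iff[OF assms])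

text \<open>All subsets of size at most \<open>k\<close> cover, each one covering itself; hence the
  minimum defining the covering number exists.\<close>

lemma covering_family_ex:
  assumes "regular k"
  shows "\<exists>X. covering_family l (csucc k) (csucc k) k X"
proof -
  note c = regular_cardinal[OF assms]
  obtain p where p: "elts p = {x. elts x \<subseteq> elts l}" using is_set_Pow unfolding is_set_def by metis
  have "is_set {x \<in> elts p. vcard x \<in> elts (csucc k)}" by (intro is_set_Collect def_pred_intros def_term_vcard)
  then obtain X where X: "elts X = {x \<in> elts p. vcard x \<in> elts (csucc k)}" unfolding is_set_def by blast
  have "\<exists>S. elts S \<subseteq> elts X \<and> vcard S \<in> elts k \<and> elts y \<subseteq> (\<Union>x\<in>elts S. elts x)"
    if "elts y \<subseteq> elts l" "injects y k" for y
  proof (intro exI conjI)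
    have e: "elts (set_of {y}) = {y}" by (rule elts_set_of[OF is_set_singleton])
    show "elts (set_of {y}) \<subseteq> elts X" unfolding e X p vcard_less_csucc_iff[OF c] using that by simp
    show "vcard (set_of {y}) \<in> elts k" by (rule small_subsingleton[OF assms, of _ y]) (simp add: e)
    show "elts y \<subseteq> (\<Union>x\<in>elts (set_of {y}). elts x)" unfolding e by simp
  qed
  moreover have "\<forall>x\<in>elts X. elts x \<subseteq> elts l \<and> injects x k"
    unfolding X p vcard_less_csucc_iff[OF c] by blast
  ultimately show ?thesis unfolding covering_family_iff[OF c] by blast
qed

lemma revised_power_attained:
  assumes "regular k"
  obtains C where "covering_family l (csucc k) (csucc k) k C" "revised_power l k = vcard C"
    "\<And>X. covering_family l (csucc k) (csucc k) k X \<Longrightarrow> revised_power l k \<le>\<^sub>V vcard X"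
proof -
  let ?cf = "covering_family l (csucc k) (csucc k) k"
  obtain X where X: "?cf X" using covering_family_ex[OF assms] by blast
  then have "\<exists>X. ?cf X \<and> vcard X = vcard X" by blast
  then obtain c where c: "\<exists>X. ?cf X \<and> c = vcard X"
    and min: "\<And>d. d \<in> elts c \<Longrightarrow> \<not> (\<exists>X. ?cf X \<and> d = vcard X)"
    using mem_least[of "\<lambda>c. \<exists>X. ?cf X \<and> c = vcard X"] X by blast
  obtain C where C: "?cf C" "c = vcard C" using c by blast
  have least: "c \<le>\<^sub>V vcard X" if "?cf X" for X
    using ord_le_total[of c "vcard X"] min[of "vcard X"] that C(2) ordinal_vcard by blast
  have "revised_power l k = c"
    unfolding revised_power_def cov_def
  proof (rule the_equality)
    show "(\<exists>X. ?cf X \<and> c = vcard X) \<and> (\<forall>X. ?cf X \<longrightarrow> c \<le>\<^sub>V vcard X)" using c least by blast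
  next
    fix d assume d: "(\<exists>X. ?cf X \<and> d = vcard X) \<and> (\<forall>X. ?cf X \<longrightarrow> d \<le>\<^sub>V vcard X)"
    then obtain D where D: "?cf D" "d = vcard D" by blast
    have "d \<le>\<^sub>V c" "c \<le>\<^sub>V d" using d C least D by auto
    then show "d = c" by (rule ord_le_antisym[rotated 2]) (simp_all add: C(2) D(2) ordinal_vcard)
  qed
  then show ?thesis using that C least by simp
qed

section \<open>Objects and labelled arrows\<close>

context
  fixes k :: 'v
  assumes k: "regular k"
begin

lemmas k_cardinal = regular_cardinal[OF k]

lemma Union_lt_iff:
  "u \<in> Union_lt k X \<longleftrightarrow> (\<exists>S. elts S \<subseteq> X \<and> vcard S \<in> elts k \<and> elts u = (\<Union>x\<in>elts S. elts x))"
  unfolding Union_lt_def elts_iff[of _ k] by simp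

lemma Union_lt_member: "x \<in> X \<Longrightarrow> x \<in> Union_lt k X"
  unfolding Union_lt_iff
  by (rule exI[of _ "set_of {x}"])
    (auto simp: elts_set_of is_set_singleton intro!: small_subsingleton[OF k, of _ x])

lemma Union_lt_empty_member: "set_of {} \<in> Union_lt k X"
  unfolding Union_lt_iff by (rule exI[of _ "set_of {}"]) (simp add: small_empty[OF k])

lemma Union_lt_empty: "Union_lt k {} = {set_of {}}"
proof -
  have "x = set_of {}" if "x \<in> Union_lt k {}" for x
    using that unfolding Union_lt_iff by (intro extensionality) auto
  then show ?thesis using Union_lt_empty_member by blast
qed

lemma def_class_Union_lt: "def_class (Union_lt k (elts C))"
  unfolding def_class_def Union_lt_iff by (intro def_pred_intros def_pred_set_eq def_pred_subset def_term_vcard)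

text \<open>By regularity, a union of fewer than \<open>k\<close> such unions is again one, once a
  family \<open>f s\<close> witnessing \<open>s\<close> is chosen for all \<open>s\<close> at once.
  The candidates are subsets of the set \<open>C\<close>, so a choice function on its power set does
  this.\<close>

lemma St_obj_Union_lt: "St_obj k (Union_lt k (elts C))"
  unfolding St_obj_def
proof
  show "is_class (Union_lt k (elts C))" by (rule is_class_if_def_class[OF def_class_Union_lt])
  show "below (Union_lt k (Union_lt k (elts C))) (Union_lt k (elts C))"
    unfolding below_def
  proof
    fix u assume "u \<in> Union_lt k (Union_lt k (elts C))"
    then obtain S where S: "elts S \<subseteq> Union_lt k (elts C)" "vcard S \<in> elts k"
      "elts u = (\<Union>x\<in>elts S. elts x)" unfolding Union_lt_iff[of _ "Union_lt k (elts C)"] by blast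
    obtain p where p: "elts p = {x. elts x \<subseteq> elts C}" using is_set_Pow unfolding is_set_def by metis
    obtain c where c: "class_fun c" "\<And>u. elts u \<subseteq> elts p \<Longrightarrow> elts u \<noteq> {} \<Longrightarrow> c u \<in> elts u"
      using choice_function by blast
    define W where "W s = {q \<in> elts p. vcard q \<in> elts k \<and> elts s = (\<Union>x\<in>elts q. elts x)}" for s
    have setW: "is_set (W s)" for s unfolding W_def by (intro is_set_Collect def_pred_intros def_pred_set_eq def_term_vcard)
    define f where "f s = c (set_of (W s))" for s
    have class_fun: "class_fun f" unfolding f_def class_fun_def
      by (rule class_fun_app[OF c(1) def_term_set_of[OF setW]]) (unfold W_def, intro def_pred_intros def_pred_set_eq def_term_vcard)
    have f: "f s \<in> W s" if s: "s \<in> elts S" for s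
    proof -
      have "s \<in> Union_lt k (elts C)" using S(1) s by blast
      then have "W s \<noteq> {}" unfolding Union_lt_iff W_def p by blast
      moreover have "W s \<subseteq> elts p" unfolding W_def by blast
      ultimately show ?thesis unfolding f_def using c(2)[of "set_of (W s)"] elts_set_of[OF setW] by simp
    qed
    define T where "T = {t \<in> elts C. \<exists>s\<in>elts S. t \<in> elts (f s)}"
    have setT: "is_set T" unfolding T_def by (intro is_set_Collect def_pred_intros class_fun_app[OF class_fun])
    have "elts u = (\<Union>x\<in>elts (set_of T). elts x)"
    proof -
      have s: "elts s = (\<Union>x\<in>elts (f s). elts x)" "elts (f s) \<subseteq> elts C" if "s \<in> elts S" for s
        using f[OF that] unfolding W_def p by blast+
      have "T = (\<Union>s\<in>elts S. elts (f s))" unfolding T_def using s(2) by auto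
      moreover have "(\<Union>s\<in>elts S. elts s) = (\<Union>s\<in>elts S. \<Union>x\<in>elts (f s). elts x)"
        by (rule SUP_cong[OF refl s(1)])
      ultimately show ?thesis unfolding S(3) elts_set_of[OF setT] by (simp only: UN_UN_flatten)
    qed
    moreover have "vcard (set_of T) \<in> elts k"
    proof (rule small_UN[OF k S(2) class_fun])
      show "vcard (f s) \<in> elts k" if "s \<in> elts S" for s using f[OF that] unfolding W_def by blast
      show "elts (set_of T) \<subseteq> (\<Union>s\<in>elts S. elts (f s))" unfolding elts_set_of[OF setT] unfolding T_def by blast
    qed
    moreover have "elts (set_of T) \<subseteq> elts C" unfolding elts_set_of[OF setT] unfolding T_def by blast
    ultimately have "u \<in> Union_lt k (elts C)" unfolding Union_lt_iff by blast
    then show "\<exists>y\<in>Union_lt k (elts C). elts u \<subseteq> elts y" by blast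
  qed
qed

lemma Union_lt_injects:
  assumes "\<And>x. x \<in> X \<Longrightarrow> injects x k" "u \<in> Union_lt k X"
  shows "injects u k"
proof -
  obtain S where S: "elts S \<subseteq> X" "vcard S \<in> elts k" "elts u = (\<Union>x\<in>elts S. elts x)"
    using assms(2) unfolding Union_lt_iff by blast
  show ?thesis by (rule small_Union_injects[OF k S(2)]) (use S assms(1) in auto)
qed

lemma vcard_le_cadd: "injects y k \<Longrightarrow> vcard y \<le>\<^sub>V cadd a k"
  using ord_le_trans[OF cardinal_ordinal[OF cadd(1)] _ le_cadd[OF k_cardinal]]
    vcard_le_cardinal_iff[OF k_cardinal] by blast

lemma vcard_le_cadd_iff: "injects x k \<Longrightarrow> vcard y \<le>\<^sub>V cadd (vcard x) k \<longleftrightarrow> injects y k"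
  by (simp add: cadd_absorb[OF k] vcard_le_cardinal_iff[OF k_cardinal])

text \<open>Directedness applies to the union of no sets, so some member contains the empty
  set.\<close>

lemma St_obj_nonempty:
  assumes "St_obj k X"
  shows "\<exists>x. x \<in> X"
  using assms Union_lt_empty_member[of X] unfolding St_obj_def below_def by blast

text \<open>The label (wf) compares sizes with a member of \<open>W\<close>; any \<open>w\<close>
  will do, because \<open>cadd (vcard w) k\<close> is at least \<open>k\<close>.\<close>

lemma St_wf_covers:
  assumes "St_wf k W Y" "y \<in> Y" "elts s \<subseteq> elts y" "injects s k"
  shows "\<exists>w\<in>W. elts s \<subseteq> elts w"
proof -
  have "St_obj k W" using assms(1) unfolding St_wf_def St_arr_def by blast
  then obtain w where w: "w \<in> W" using St_obj_nonempty by blast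
  then obtain w' where "w' \<in> W" "vcard s \<le>\<^sub>V cadd (vcard w) k \<longrightarrow> elts s \<subseteq> elts w'"
    using assms(1-3) unfolding St_wf_def by blast
  then show ?thesis using vcard_le_cadd[OF assms(4)] by blast
qed

lemma below_singletons:
  assumes "St_wf k W {b}" "St_arr k W X" "a \<in> elts b"
  shows "\<exists>x\<in>X. a \<in> elts x"
proof -
  have e: "elts (set_of {a}) = {a}" by (rule elts_set_of[OF is_set_singleton])
  have "injects (set_of {a}) k" by (rule small_le[OF k small_subsingleton[OF k]]) (simp add: e)
  then obtain w where w: "w \<in> W" "a \<in> elts w"
    using St_wf_covers[OF assms(1), of b "set_of {a}"] assms(3) unfolding e by auto
  then show ?thesis using assms(2) unfolding St_arr_def below_def by blast
qed

text \<open>Each point of \<open>B\<close> lies in a member of \<open>W\<close>, since (wf) applies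
  to singletons, and therefore in \<open>m\<close>, which is itself a member.\<close>

lemma Qt_obj_singleton: "Qt_obj k {m}"
  unfolding Qt_obj_def cute_def
proof (intro conjI allI impI)
  have e: "elts (set_of {m}) = {m}" by (rule elts_set_of[OF is_set_singleton])
  show "is_class {m}" using is_class_if_def_class[OF def_class_elts, of "set_of {m}"] unfolding e .
  show obj: "St_obj k (Union_lt k {m})" using St_obj_Union_lt[of "set_of {m}"] unfolding e .
  fix A B W
  assume *: "elts A \<subseteq> elts B \<and> St_c k {A} {B} \<and> St_obj k W \<and> St_wf k W {B} \<and>
    St_arr k W (Union_lt k {m}) \<and> St_arr k {A} (Union_lt k {m})"
  have m: "elts x \<subseteq> elts m" if "x \<in> Union_lt k {m}" for x
    using that unfolding Union_lt_iff by auto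
  have "elts B \<subseteq> elts m" using below_singletons[of W B "Union_lt k {m}"] * m by blast
  moreover have "St_obj k {B}" using * unfolding St_c_def St_arr_def by blast
  ultimately show "St_arr k {B} (Union_lt k {m})"
    unfolding St_arr_def below_def using obj Union_lt_member[of m "{m}"] by auto
qed

text \<open>\<open>A\<close> lies in a union of fewer than \<open>k\<close> members, so it has size
  at most \<open>k\<close>. Then (c) bounds \<open>B\<close> by \<open>k\<close>, and (wf) puts the
  whole of \<open>B\<close> into one member of \<open>W\<close>.\<close>

lemma Qt_obj_elts:
  assumes C: "\<And>x. x \<in> elts C \<Longrightarrow> injects x k"
  shows "Qt_obj k (elts C)"
  unfolding Qt_obj_def cute_def
proof (intro conjI allI impI)
  let ?X = "Union_lt k (elts C)"
  show "is_class (elts C)" by (rule is_class_if_def_class[OF def_class_elts])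
  show obj: "St_obj k ?X" by (rule St_obj_Union_lt)
  fix A B W
  assume *: "elts A \<subseteq> elts B \<and> St_c k {A} {B} \<and> St_obj k W \<and> St_wf k W {B} \<and>
    St_arr k W ?X \<and> St_arr k {A} ?X"
  obtain x where "x \<in> ?X" "elts A \<subseteq> elts x" using * unfolding St_arr_def below_def by blast
  then have "injects A k" using Union_lt_injects[OF C] injects_trans injects_subset by blast
  moreover have "vcard B \<le>\<^sub>V cadd (vcard A) k" using * unfolding St_c_def by blast
  ultimately have "injects B k" using vcard_le_cadd_iff by blast
  then obtain w where "w \<in> W" "elts B \<subseteq> elts w" using St_wf_covers[of W "{B}" B B] * by blast
  moreover have "below W ?X" using * unfolding St_arr_def by blast
  ultimately obtain y where "y \<in> ?X" "elts B \<subseteq> elts y" unfolding below_def by blast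
  moreover have "St_obj k {B}" using * unfolding St_c_def St_arr_def by blast
  ultimately show "St_arr k {B} ?X" unfolding St_arr_def below_def using obj by blast
qed

section \<open>Upper bound: the zigzag given by a covering family\<close>

lemma Qt_obj_St_obj: "Qt_obj k X \<Longrightarrow> St_obj k (Union_lt k X)"
  unfolding Qt_obj_def cute_def by blast

lemma below_refl: "below X X"
  unfolding below_def by blast

lemma Qt_arr_refl: "Qt_obj k X \<Longrightarrow> Qt_arr k X X"
  unfolding Qt_arr_def St_arr_def using Qt_obj_St_obj below_refl by blast

text \<open>The intermediate object for the label (w) is \<open>Union_lt k (elts C)\<close> itself,
  reached by an identity, which has the label (wc). Its members have size at most \<open>k\<close>,
  so (wf) asks for precisely the sets that the family covers.\<close>

lemma covering_family_Qt_w: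
  assumes C: "covering_family m (csucc k) (csucc k) k C"
  shows "Qt_w k (elts C) {m}"
proof -
  have sub: "elts x \<subseteq> elts m" and inj: "injects x k" if "x \<in> elts C" for x
    using C that unfolding covering_family_iff[OF k_cardinal] by blast+
  have cov: "\<exists>x\<in>Union_lt k (elts C). elts y \<subseteq> elts x" if y: "elts y \<subseteq> elts m" "injects y k" for y
  proof -
    obtain S where S: "elts S \<subseteq> elts C" "vcard S \<in> elts k" "elts y \<subseteq> (\<Union>x\<in>elts S. elts x)"
      using C y unfolding covering_family_iff[OF k_cardinal] by blast
    obtain u where u: "elts u = (\<Union>x\<in>elts S. elts x)" using is_set_UN unfolding is_set_def by metis
    have "u \<in> Union_lt k (elts C)" unfolding Union_lt_iff using S(1,2) u by (intro exI[of _ S] conjI)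
    then show ?thesis using S(3) u by auto
  qed
  have sub_Union: "elts x \<subseteq> elts m" if x: "x \<in> Union_lt k (elts C)" for x
    using x sub unfolding Union_lt_iff by blast
  have sub_m: "elts x \<subseteq> elts m" if x: "x \<in> Union_lt k {m}" for x
    using x unfolding Union_lt_iff by auto
  have obj: "Qt_obj k (elts C)" "Qt_obj k {m}" using Qt_obj_elts[OF inj] Qt_obj_singleton by auto
  note St = Qt_obj_St_obj[OF obj(1)] Qt_obj_St_obj[OF obj(2)]
  have arr: "St_arr k (Union_lt k (elts C)) (Union_lt k {m})"
    unfolding St_arr_def below_def using St sub_Union Union_lt_member[of m "{m}"] by blast
  have "St_wc k (Union_lt k (elts C)) (Union_lt k (elts C))"
    unfolding St_wc_def St_arr_def elts_iff[of _ k, symmetric]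
    using St(1) below_refl small_Diff_self[OF k] by blast
  moreover have "St_wf k (Union_lt k (elts C)) (Union_lt k {m})"
    unfolding St_wf_def
  proof (intro conjI arr ballI allI impI)
    fix x y y' assume x: "x \<in> Union_lt k (elts C)" and y: "y \<in> Union_lt k {m}" and y': "elts y' \<subseteq> elts y"
    have y'm: "elts y' \<subseteq> elts m" using y' sub_m[OF y] by blast
    have "vcard y' \<le>\<^sub>V cadd (vcard x) k \<longleftrightarrow> injects y' k"
      by (rule vcard_le_cadd_iff[OF Union_lt_injects[OF inj x]])
    then show "\<exists>x'\<in>Union_lt k (elts C). vcard y' \<le>\<^sub>V cadd (vcard x) k \<longrightarrow> elts y' \<subseteq> elts x'"
      using cov[OF y'm] x by blast
  qed
  ultimately show ?thesis unfolding Qt_w_def Qt_arr_def St_w_def using obj arr by blast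
qed

lemma covering_family_Qt_h:
  assumes C: "covering_family m (csucc k) (csucc k) k C"
  shows "Qt_h k {m} (elts C)"
  unfolding Qt_h_def
proof (intro exI conjI)
  \<comment> \<open>All arrows but the backward one from \<open>F 2\<close> to \<open>F 1\<close>
    are identities; 3 is the least odd length that allows a backward arrow.\<close>
  let ?F = "\<lambda>i::nat. if i < 2 then {m} else elts C"
  have w: "Qt_w k (elts C) {m}" by (rule covering_family_Qt_w[OF C])
  have obj: "Qt_obj k (elts C)" "Qt_obj k {m}" using w unfolding Qt_w_def Qt_arr_def by blast+
  show "odd (3::nat)" by simp
  show "?F 0 = {m}" by simp
  show "Qt_arr k (?F 3) (elts C)" using Qt_arr_refl[OF obj(1)] by simp
  show "\<forall>i<3. if even i then Qt_arr k (?F i) (?F (Suc i)) else Qt_w k (?F (Suc i)) (?F i)"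
    using Qt_arr_refl[OF obj(1)] Qt_arr_refl[OF obj(2)] w by (auto simp: numeral_3_eq_3 less_Suc_eq)
qed

lemma covering_family_Qt_c:
  assumes C: "covering_family m (csucc k) (csucc k) k C"
  shows "Qt_c k {} (elts C)"
proof -
  have inj: "injects x k" if "x \<in> elts C" for x
    using C that unfolding covering_family_iff[OF k_cardinal] by blast
  have obj: "Qt_obj k (elts C)" "Qt_obj k {}"
    using Qt_obj_elts[OF inj] Qt_obj_elts[of "set_of {}"] by auto
  have arr: "St_arr k (Union_lt k {}) (Union_lt k (elts C))"
    unfolding St_arr_def below_def using Qt_obj_St_obj[OF obj(1)] Qt_obj_St_obj[OF obj(2)]
      Union_lt_empty_member[of "elts C"] unfolding Union_lt_empty by auto
  have "\<exists>x\<in>Union_lt k {}. vcard y \<le>\<^sub>V cadd (vcard x) k" if y: "y \<in> Union_lt k (elts C)" for y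
    using vcard_le_cadd[OF Union_lt_injects[OF inj y]] unfolding Union_lt_empty by blast
  then show ?thesis unfolding Qt_c_def Qt_arr_def St_c_def using obj arr by blast
qed

section \<open>Lower bound: covering up to fewer than \<kappa> points\<close>

definition almost_covers :: "'v set \<Rightarrow> 'v \<Rightarrow> bool" where
  "almost_covers X m \<longleftrightarrow> (\<forall>s. elts s \<subseteq> elts m \<and> injects s k \<longrightarrow>
     (\<exists>x\<in>X. vcard (set_of (elts s - elts x)) \<in> elts k))"

lemma small_Diff_mono:
  assumes "vcard (set_of (elts s - elts x)) \<in> elts k" "elts s - elts y \<subseteq> elts s - elts x"
  shows "vcard (set_of (elts s - elts y)) \<in> elts k"
  using small_subset[OF k _ assms(1)] assms(2) by (simp add: elts_set_of is_set_Diff)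

lemma almost_covers_below:
  assumes "below X Y" "almost_covers X m"
  shows "almost_covers Y m"
  unfolding almost_covers_def
proof (intro allI impI)
  fix s assume "elts s \<subseteq> elts m \<and> injects s k"
  then obtain x where x: "x \<in> X" "vcard (set_of (elts s - elts x)) \<in> elts k"
    using assms(2) unfolding almost_covers_def by blast
  then obtain y where y: "y \<in> Y" "elts x \<subseteq> elts y" using assms(1) unfolding below_def by blast
  have "vcard (set_of (elts s - elts y)) \<in> elts k" by (rule small_Diff_mono[OF x(2)]) (use y(2) in blast)
  then show "\<exists>y\<in>Y. vcard (set_of (elts s - elts y)) \<in> elts k" using y(1) by blast
qed

text \<open>Two losses of fewer than \<open>k\<close> points add up: \<open>y\<close> misses part of
  \<open>s\<close>, the rest lies in some \<open>z\<close> by (wf), and \<open>x\<close> misses part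
  of \<open>z\<close> by (wc).\<close>

lemma almost_covers_St_w:
  assumes "St_w k X Y" "almost_covers Y m"
  shows "almost_covers X m"
  unfolding almost_covers_def
proof (intro allI impI)
  fix s assume s: "elts s \<subseteq> elts m \<and> injects s k"
  obtain Z where Z: "St_wc k X Z" "St_wf k Z Y" using assms(1) unfolding St_w_def by blast
  obtain y where y: "y \<in> Y" "vcard (set_of (elts s - elts y)) \<in> elts k"
    using assms(2) s unfolding almost_covers_def by blast
  obtain s' where s': "elts s' = elts s \<inter> elts y" using is_set_Int unfolding is_set_def by metis
  have "injects s' k" using s s' by (intro injects_trans[OF injects_subset[of s' s]]) auto
  then obtain z where z: "z \<in> Z" "elts s' \<subseteq> elts z" using St_wf_covers[OF Z(2) y(1), of s'] s' by blast
  obtain x where x: "x \<in> X" "vcard (set_of (elts z - elts x)) \<in> elts k"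
    using Z(1) z(1) unfolding St_wc_def elts_iff[of _ k] by blast
  have "vcard (set_of (elts s - elts x)) \<in> elts k"
    by (rule small_Un[OF k y(2) x(2)]) (use z(2) s' in \<open>auto simp: elts_set_of is_set_Diff\<close>)
  then show "\<exists>x\<in>X. vcard (set_of (elts s - elts x)) \<in> elts k" using x(1) by blast
qed

lemma Qt_h_almost_covers:
  assumes "Qt_h k {m} Y"
  shows "almost_covers (Union_lt k Y) m"
proof -
  obtain n F where F: "F 0 = {m}" "Qt_arr k (F n) Y"
    "\<And>i. i < n \<Longrightarrow> if even i then Qt_arr k (F i) (F (Suc i)) else Qt_w k (F (Suc i)) (F i)"
    using assms unfolding Qt_h_def by blast
  have arr: "almost_covers (Union_lt k B) m" if "Qt_arr k A B" "almost_covers (Union_lt k A) m" for A B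
    using that almost_covers_below unfolding Qt_arr_def St_arr_def by blast
  have w: "almost_covers (Union_lt k A) m" if "Qt_w k A B" "almost_covers (Union_lt k B) m" for A B
    using that almost_covers_St_w unfolding Qt_w_def by blast
  have "vcard (set_of (elts s - elts m)) \<in> elts k" if "elts s \<subseteq> elts m" for s
    by (rule small_empty[OF k]) (use that in \<open>simp add: elts_set_of is_set_Diff\<close>)
  then have "almost_covers (Union_lt k {m}) m"
    unfolding almost_covers_def using Union_lt_member[of m "{m}"] by blast
  then have "almost_covers (Union_lt k (F i)) m" if "i \<le> n" for i
    using that
  proof (induction i)
    case 0
    then show ?case using F(1) by simp
  next
    case (Suc i)
    then have "almost_covers (Union_lt k (F i)) m" by simp
    then show ?case using F(3)[of i] Suc.prems arr w by (cases "even i") auto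
  qed
  then show ?thesis using arr[OF F(2)] by simp
qed

lemma Qt_c_empty_injects:
  assumes "Qt_c k {} Y" "y \<in> Y"
  shows "injects y k"
proof -
  have "vcard y \<le>\<^sub>V cadd (vcard (set_of {})) k"
    using assms Union_lt_member[of y Y] unfolding Qt_c_def St_c_def Union_lt_empty by blast
  moreover have "injects (set_of {}) k" by (rule injects_subset) simp
  ultimately show ?thesis using vcard_le_cadd_iff by blast
qed

text \<open>Otherwise \<open>R\<close> contains a copy of \<open>k\<close>. It has size at most
  \<open>k\<close>, but it is disjoint from every union of members of \<open>Y\<close>, so all of
  its points would be lost.\<close>

lemma almost_covers_uncovered_small:
  assumes "almost_covers (Union_lt k Y) m" "elts R \<subseteq> elts m" "\<And>y. y \<in> Y \<Longrightarrow> elts R \<inter> elts y = {}"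
  shows "vcard R \<in> elts k"
  unfolding small_iff[OF k]
proof
  assume "injects k R"
  then obtain h where h: "class_fun h" "inj_on h (elts k)" "h ` elts k \<subseteq> elts R" unfolding injects_def by blast
  obtain s where s: "elts s = h ` elts k" using is_set_image[OF h(1)] unfolding is_set_def by metis
  have "s \<approx>\<^sub>V k" using eqv_image[OF h(1,2)] s by (metis set_of_elts)
  then have sk: "injects s k" "injects k s" using injects_eqv eqv_sym by blast+
  moreover have "elts s \<subseteq> elts m" using s h(3) assms(2) by blast
  ultimately obtain u where u: "u \<in> Union_lt k Y" "vcard (set_of (elts s - elts u)) \<in> elts k"
    using assms(1) unfolding almost_covers_def by blast
  have "elts s \<inter> elts u = {}" using u(1) assms(3) s h(3) unfolding Union_lt_iff by blast
  then have "elts s - elts u = elts s" by blast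
  then show False using u(2) sk(2) small_iff[OF k] by simp
qed



text \<open>\<open>P y\<close> is \<open>y\<close> cut down to \<open>m\<close> and enlarged by the
  uncovered part \<open>R\<close>. To cover \<open>s\<close>, take the members forming the almost
  covering \<open>u\<close>, and for each lost point outside \<open>R\<close> one member
  \<open>f a\<close> containing it; fewer than \<open>k\<close> members result. The family is an
  image of \<open>Y\<close>, hence no larger.\<close>

lemma almost_covers_covering_family:
  assumes "almost_covers (Union_lt k (elts Y)) m" "\<And>y. y \<in> elts Y \<Longrightarrow> injects y k"
    and "elts m = {} \<or> k \<le>\<^sub>V m" "cardinal m"
  shows "\<exists>X. covering_family m (csucc k) (csucc k) k X \<and> vcard X \<le>\<^sub>V vcard Y"
proof -
  have "is_set {a \<in> elts m. \<forall>y\<in>elts Y. a \<notin> elts y}" by (intro is_set_Collect def_pred_intros)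
  then obtain R where R: "elts R = {a \<in> elts m. \<forall>y\<in>elts Y. a \<notin> elts y}" unfolding is_set_def by blast
  have smallR: "vcard R \<in> elts k"
    by (rule almost_covers_uncovered_small[OF assms(1)]) (use R in blast)+
  show ?thesis
  proof (cases "elts Y = {}")
    \<comment> \<open>All of \<open>m\<close> is uncovered, hence of size below \<open>k\<close>; by
      the assumption on \<open>m\<close> it is empty, and the empty family covers it.\<close>
    case True
    then have "R = m" using R by (intro extensionality) blast
    then have "m \<in> elts k" using smallR vcard_cardinal[OF assms(4)] by simp
    then have "\<not> k \<le>\<^sub>V m" using ord_le_mem_trans[OF regular_ordinal[OF k]] mem_irrefl by blast
    then have m: "elts m = {}" using assms(3) by blast
    have "covering_family m (csucc k) (csucc k) k Y"
      unfolding covering_family_iff[OF k_cardinal] m True using small_empty[OF k True] True by auto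
    then show ?thesis using ord_le_refl by blast
  next
    case False
    then obtain y1 where y1: "y1 \<in> elts Y" by blast
    define P where "P y = {a \<in> elts m. a \<in> elts y \<or> a \<in> elts R}" for y
    define \<phi> where "\<phi> y = set_of (P y)" for y
    have setP: "is_set (P y)" for y unfolding P_def by (intro is_set_Collect def_pred_intros)
    have class_fun\<phi>: "class_fun \<phi>" unfolding \<phi>_def class_fun_def by (rule def_term_set_of[OF setP]) (unfold P_def, intro def_pred_intros)
    have \<phi>: "elts (\<phi> y) = P y" for y unfolding \<phi>_def by (rule elts_set_of[OF setP])
    obtain X where X: "elts X = \<phi> ` elts Y" using is_set_image[OF class_fun\<phi>] unfolding is_set_def by metis
    obtain c where c: "class_fun c" "\<And>u. elts u \<subseteq> elts Y \<Longrightarrow> elts u \<noteq> {} \<Longrightarrow> c u \<in> elts u"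
      using choice_function by blast
    define Q where "Q a = {y \<in> elts Y. a \<in> elts y}" for a
    define f where "f a = c (set_of (Q a))" for a
    have setQ: "is_set (Q a)" for a unfolding Q_def by (intro is_set_Collect def_pred_intros)
    have DFf: "class_fun f" unfolding f_def class_fun_def
      by (rule class_fun_app[OF c(1) def_term_set_of[OF setQ]]) (unfold Q_def, intro def_pred_intros)
    have f: "f a \<in> Q a" if "Q a \<noteq> {}" for a
      using c(2)[of "set_of (Q a)"] that unfolding f_def elts_set_of[OF setQ] unfolding Q_def by blast
    have "\<exists>S. elts S \<subseteq> elts X \<and> vcard S \<in> elts k \<and> elts s \<subseteq> (\<Union>x\<in>elts S. elts x)"
      if s: "elts s \<subseteq> elts m" "injects s k" for s
    proof -
      obtain u where u: "u \<in> Union_lt k (elts Y)" "vcard (set_of (elts s - elts u)) \<in> elts k"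
        using assms(1) s unfolding almost_covers_def by blast
      obtain S where S: "elts S \<subseteq> elts Y" "vcard S \<in> elts k" "elts u = (\<Union>x\<in>elts S. elts x)"
        using u(1) unfolding Union_lt_iff by blast
      have "is_set {a \<in> elts s. a \<notin> elts u \<and> a \<notin> elts R}" by (intro is_set_Collect def_pred_intros)
      then obtain D where D: "elts D = {a \<in> elts s. a \<notin> elts u \<and> a \<notin> elts R}" unfolding is_set_def by blast
      have "vcard D \<in> elts k"
        by (rule small_subset[OF k _ u(2)]) (auto simp: D elts_set_of is_set_Diff)
      obtain E where E: "elts E = f ` elts D" using is_set_image[OF DFf] unfolding is_set_def by metis
      have "vcard E \<in> elts k"
        using small_injects[OF k injects_surj[OF DFf]] E \<open>vcard D \<in> elts k\<close> by blast
      obtain S1 where S1: "elts S1 = elts S \<union> elts E" using is_set_Un unfolding is_set_def by metis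
      \<comment> \<open>Adding \<open>y1\<close> makes the selection nonempty, so that the points of
        \<open>R\<close> are covered.\<close>
      obtain S2 where S2: "elts S2 = insert y1 (elts S1)" using is_set_insert unfolding is_set_def by metis
      have "vcard S1 \<in> elts k" using small_Un[OF k S(2) \<open>vcard E \<in> elts k\<close>] S1 by simp
      moreover have "vcard (set_of {y1}) \<in> elts k"
        by (rule small_subsingleton[OF k, of _ y1]) (simp add: elts_set_of is_set_singleton)
      ultimately have "vcard S2 \<in> elts k"
        by (rule small_Un[OF k]) (simp add: S2 elts_set_of is_set_singleton)
      obtain S3 where S3: "elts S3 = \<phi> ` elts S2" using is_set_image[OF class_fun\<phi>] unfolding is_set_def by metis
      have "vcard S3 \<in> elts k"
        using small_injects[OF k injects_surj[OF class_fun\<phi>]] S3 \<open>vcard S2 \<in> elts k\<close> by blast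
      have fD: "f a \<in> elts Y" "a \<in> elts (f a)" if "a \<in> elts D" for a
      proof -
        have "a \<in> elts m" "a \<notin> elts R" using that s(1) unfolding D by auto
        then have "Q a \<noteq> {}" unfolding Q_def R by blast
        then show "f a \<in> elts Y" "a \<in> elts (f a)" using f[of a] unfolding Q_def by auto
      qed
      have "elts S2 \<subseteq> elts Y" unfolding S2 S1 E using S(1) y1 fD(1) by blast
      then have "elts S3 \<subseteq> elts X" unfolding S3 X by blast
      moreover have "a \<in> (\<Union>x\<in>elts S3. elts x)" if a: "a \<in> elts s" for a
      proof -
        have am: "a \<in> elts m" using a s(1) by blast
        have "\<exists>y\<in>elts S2. a \<in> P y"
        proof (cases "a \<in> elts R")
          case True
          then show ?thesis unfolding P_def S2 using am by blast
        next
          case aR: False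
          show ?thesis
          proof (cases "a \<in> elts u")
            case True
            then show ?thesis unfolding P_def S2 S1 using S(3) am by blast
          next
            case False
            then have "a \<in> elts D" using a aR unfolding D by blast
            then show ?thesis unfolding P_def S2 S1 E using fD(2) am by blast
          qed
        qed
        then show ?thesis unfolding S3 using \<phi> by blast
      qed
      ultimately show ?thesis using \<open>vcard S3 \<in> elts k\<close> by blast
    qed
    moreover have "elts x \<subseteq> elts m \<and> injects x k" if "x \<in> elts X" for x
    proof -
      obtain y where y: "y \<in> elts Y" "x = \<phi> y" using \<open>x \<in> elts X\<close> unfolding X by blast
      have "injects x k"
        by (rule Un_injects[OF k assms(2)[OF y(1)] small_le[OF k smallR]]) (auto simp: y(2) \<phi> P_def)
      then show ?thesis unfolding y(2) \<phi> P_def by blast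
    qed
    ultimately have "covering_family m (csucc k) (csucc k) k X"
      unfolding covering_family_iff[OF k_cardinal] by blast
    moreover have "vcard X \<le>\<^sub>V vcard Y"
      unfolding vcard_le_iff using injects_surj[OF class_fun\<phi>] X by blast
    ultimately show ?thesis by blast
  qed
qed

lemma Lc_card_singleton:
  assumes "cardinal m" "elts m = {} \<or> k \<le>\<^sub>V m"
  shows "Lc_card k {m} = Ord (revised_power m k)"
proof -
  let ?r = "revised_power m k"
  obtain C where C: "covering_family m (csucc k) (csucc k) k C" "?r = vcard C"
    and least: "\<And>X. covering_family m (csucc k) (csucc k) k X \<Longrightarrow> ?r \<le>\<^sub>V vcard X"
    by (rule revised_power_attained[OF k, of m]) (rule that)
  have att: "Qt_h k {m} (elts C) \<and> Qt_c k {} (elts C) \<and> Ord ?r = class_card (elts C)"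
    using covering_family_Qt_h[OF C(1)] covering_family_Qt_c[OF C(1)] C(2) by (simp add: class_card_def)
  \<comment> \<open>A proper class has cardinality \<open>Top\<close>, so only sets \<open>Y\<close>
    require the covering argument.\<close>
  have lower: "top_le (Ord ?r) (class_card Y)" if h: "Qt_h k {m} Y" and c: "Qt_c k {} Y" for Y
  proof (cases "is_set Y")
    case True
    then obtain y where Y: "Y = elts y" unfolding is_set_def by blast
    obtain X where X: "covering_family m (csucc k) (csucc k) k X" "vcard X \<le>\<^sub>V vcard y"
      using almost_covers_covering_family[of y m] Qt_h_almost_covers[OF h]
        Qt_c_empty_injects[OF c] assms unfolding Y by blast
    have "?r \<le>\<^sub>V vcard y" by (rule ord_le_trans[OF ordinal_vcard least[OF X(1)] X(2)])
    then show ?thesis unfolding Y by (simp add: class_card_def)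
  qed (simp add: class_card_def)
  show ?thesis
    unfolding Lc_card_def
  proof (rule the_equality)
    show "(\<exists>Y. Qt_h k {m} Y \<and> Qt_c k {} Y \<and> Ord ?r = class_card Y) \<and>
      (\<forall>Y. Qt_h k {m} Y \<and> Qt_c k {} Y \<longrightarrow> top_le (Ord ?r) (class_card Y))"
      using att lower by blast
  next
    fix n assume n: "(\<exists>Y. Qt_h k {m} Y \<and> Qt_c k {} Y \<and> n = class_card Y) \<and>
      (\<forall>Y. Qt_h k {m} Y \<and> Qt_c k {} Y \<longrightarrow> top_le n (class_card Y))"
    then obtain Y where Y: "Qt_h k {m} Y" "Qt_c k {} Y" "n = class_card Y" by blast
    have le: "top_le n (Ord ?r)" using n att by metis
    then obtain b where b: "n = Ord b" by (cases n) auto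
    then have "b = vcard (set_of Y)" using Y(3) unfolding class_card_def by (auto split: if_splits)
    then have "ordinal b" by (simp add: ordinal_vcard)
    moreover have "b \<le>\<^sub>V ?r" "?r \<le>\<^sub>V b" using le lower[OF Y(1,2)] b Y(3) by auto
    ultimately show "n = Ord ?r" unfolding b C(2)
      by (simp add: ord_le_antisym[OF _ ordinal_vcard])
  qed
qed

end

end

theorem mainTheorem2:
  fixes mem :: "'v \<Rightarrow> 'v \<Rightarrow> bool" and \<kappa> \<mu> :: 'v
  assumes "transitive_zfc_model mem"
    and "membership.regular mem \<kappa>"
    and "membership.cardinal mem \<mu>"
    and "membership.elts mem \<mu> = {} \<or> membership.ord_le mem \<kappa> \<mu>"
  shows "membership.Lc_card mem \<kappa> {\<mu>} = Ord (membership.revised_power mem \<mu> \<kappa>)"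
proof -
  interpret transitive_zfc_model mem by (rule assms(1))
  show ?thesis using assms(2-4) by (rule Lc_card_singleton)
qed

end
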